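(* Every geometric Lorenz attractor $\Lambda\subset\mathbb{R}^3$ has Hausdorff dimension strictly greater than $2$: $HD(\Lambda)>2$.
   Context: $HD$ denotes Hausdorff dimension. Geometric Lorenz flow. Fix real numbers $\lambda_1,\lambda_2,\lambda_3$ with $0<-\lambda_3<\lambda_1<-\lambda_2$ and put $\alpha=-\lambda_3/\lambda_1\in(0,1)$, $\beta=-\lambda_2/\lambda_1>1$. In the cube $[-1,1]^3$ the vector field $X$ is linear, $(\dot x,\dot y,\dot z)=(\lambda_1x,\lambda_2y,\lambda_3z)$, with singularity $O=(0,0,0)$. Let $I=[-1/2,1/2]$, $S=\{(x,y,1):|x|\le 1/2,|y|\le 1/2\}$, $\Gamma=\{(x,y,1)\in S:x=0\}$ (contained in the stable manifold of $O$), $S^\star=S\setminus\Gamma$. The orbit of $(x,y,1)\in S^\star$ leaves the cube through $\{|x|=1\}$ at the point $(\operatorname{sgn}(x),y|x|^\beta,|x|^\alpha)$. Outside the cube, the vector field carries these exit points back to the cross-section $S$, in bounded time, realizing a composition of a rotation, an expansion and a translation that takes segments $\{z=\text{const}\}$ of the exit section to segments $\{x=\text{const}\}$ of $S$; $S$ is transverse to the flow and every trajectory eventually crosses it. Identifying $(x,y,1)$ with $(x,y)$, the resulting Poincaré map $P:S^\star\to S$ has the form $P(x,y)=(f(x),g(x,y))$, where - $f(x)=f_0(|x|^\alpha)$ for $x>0$ and $f(x)=f_1(|x|^\alpha)$ for $x<0$, with $f_i(u)=(-1)^i\theta u+b_i$ ($i=0,1$), and $f:I\setminus\{0\}\to I$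 satisfies: $f(0^-)=1/2$, $f(0^+)=-1/2$; $f'(x)>\sqrt2$ for all $x\in I\setminus\{0\}$; $f'(0^-)=f'(0^+)=+\infty$; $f(-1/2)\ne-1/2$ and $f(1/2)\neq 1/2$; - $g(x,y)=g_0(|x|^\alpha,y|x|^\beta)$ for $x>0$ and $g(x,y)=g_1(|x|^\alpha,y|x|^\beta)$ for $x<0$, with $g_0,g_1$ affine maps with values in $I$, such that $|\partial_yg|=|x|^\beta<\lambda$ for some $\lambda\in(0,1)$ and $|\partial_xg|$ is bounded. Set $\Lambda_P=\overline{\bigcap_{i\ge1}P^i(S^\star)}$ (with $P^i$ applied wherever it is defined). The geometric Lorenz attractor of the flow $X^t$ is $\Lambda=\Big(\bigcup_{t\in\mathbb{R}}X^t(\Lambda_P)\Big)\cup\{O\}$. *)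

theory Defs
  imports "HOL-Analysis.Analysis"
begin

section \<open>Hausdorff dimension\<close>

text \<open>
  The size of a covering set is \<open>diam(U)\<^sup>s\<close> with the conventions \<open>0\<^sup>0 = 1\<close> for nonempty \<open>U\<close>
  (whereas \<open>0 powr 0 = 0\<close>) and size \<open>0\<close> for the empty set, so that the measure for \<open>s = 0\<close> is the
  counting measure.  Covering sets have to be bounded explicitly because \<^const>\<open>diameter\<close> carries
  no information on unbounded sets.
\<close>

definition hausdorff_gauge :: "real \<Rightarrow> 'a::metric_space set \<Rightarrow> ennreal" where
  "hausdorff_gauge s U =
     (if U = {} then 0 else if s = 0 then 1 else ennreal (diameter U powr s))"

definition hausdorff_premeasure :: "real \<Rightarrow> real \<Rightarrow> 'a::metric_space set \<Rightarrow> ennreal" where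
  "hausdorff_premeasure s \<delta> A =
     (INF U \<in> {U :: nat \<Rightarrow> 'a set. A \<subseteq> (\<Union>i. U i) \<and> (\<forall>i. bounded (U i) \<and> diameter (U i) \<le> \<delta>)}.
        \<Sum>i. hausdorff_gauge s (U i))"

definition hausdorff_measure :: "real \<Rightarrow> 'a::metric_space set \<Rightarrow> ennreal" where
  "hausdorff_measure s A = (SUP \<delta> \<in> {0<..}. hausdorff_premeasure s \<delta> A)"

definition hausdorff_dim :: "'a::metric_space set \<Rightarrow> ennreal" where
  "hausdorff_dim A = (INF s \<in> {s. 0 \<le> s \<and> hausdorff_measure s A = 0}. ennreal s)"


section \<open>Vector fields and flows\<close>

definition C1_field :: "('a::euclidean_space \<Rightarrow> 'a) \<Rightarrow> bool" where
  "C1_field X \<longleftrightarrow>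
     (\<exists>D :: 'a \<Rightarrow> 'a \<Rightarrow>\<^sub>L 'a.
        (\<forall>p. (X has_derivative blinfun_apply (D p)) (at p)) \<and> continuous_on UNIV D)"

definition is_flow_of :: "('a::euclidean_space \<Rightarrow> 'a) \<Rightarrow> (real \<Rightarrow> 'a \<Rightarrow> 'a) \<Rightarrow> bool" where
  "is_flow_of X \<phi> \<longleftrightarrow>
     (\<forall>p. \<phi> 0 p = p) \<and>
     (\<forall>s t p. \<phi> (s + t) p = \<phi> s (\<phi> t p)) \<and>
     (\<forall>t p. ((\<lambda>s. \<phi> s p) has_vector_derivative X (\<phi> t p)) (at t))"

text \<open>
  The first return to \<open>S\<close> under \<open>\<phi>\<close>.  The value is meaningful only at points for which the set of
  positive return times is nonempty and has a positive least element.
\<close>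

definition return_time :: "(real \<Rightarrow> 'a \<Rightarrow> 'a) \<Rightarrow> 'a set \<Rightarrow> 'a \<Rightarrow> real" where
  "return_time \<phi> S p = Inf {t. 0 < t \<and> \<phi> t p \<in> S}"

definition poincare_map :: "(real \<Rightarrow> 'a \<Rightarrow> 'a) \<Rightarrow> 'a set \<Rightarrow> 'a \<Rightarrow> 'a" where
  "poincare_map \<phi> S p = \<phi> (return_time \<phi> S p) p"


section \<open>The geometric Lorenz flow\<close>

definition cube :: "(real^3) set" where
  "cube = {p. \<forall>i. \<bar>p $ i\<bar> \<le> 1}"

definition lorenz_I :: "real set" where
  "lorenz_I = {-1/2..1/2}"

definition section_point :: "real \<Rightarrow> real \<Rightarrow> real^3" where
  "section_point x y = vector [x, y, 1]"

definition lorenz_S :: "(real^3) set" where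
  "lorenz_S = {section_point x y | x y. x \<in> lorenz_I \<and> y \<in> lorenz_I}"

definition lorenz_Gamma :: "(real^3) set" where
  "lorenz_Gamma = {p \<in> lorenz_S. p $ 1 = 0}"

definition lorenz_S_star :: "(real^3) set" where
  "lorenz_S_star = lorenz_S - lorenz_Gamma"

text \<open>The point at which the orbit of \<open>(x, y, 1)\<close>, \<open>x \<noteq> 0\<close>, leaves the cube.\<close>

definition exit_point :: "real \<Rightarrow> real \<Rightarrow> real \<Rightarrow> real \<Rightarrow> real^3" where
  "exit_point \<alpha> \<beta> x y = vector [sgn x, y * \<bar>x\<bar> powr \<beta>, \<bar>x\<bar> powr \<alpha>]"

definition lorenz_f :: "real \<Rightarrow> real \<Rightarrow> real \<Rightarrow> real \<Rightarrow> real \<Rightarrow> real" where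
  "lorenz_f \<alpha> \<theta> b0 b1 x =
     (if x > 0 then \<theta> * \<bar>x\<bar> powr \<alpha> + b0 else - \<theta> * \<bar>x\<bar> powr \<alpha> + b1)"

definition lorenz_g ::
  "real \<Rightarrow> real \<Rightarrow> (real \<times> real \<Rightarrow> real) \<Rightarrow> (real \<times> real \<Rightarrow> real) \<Rightarrow> real \<Rightarrow> real \<Rightarrow> real" where
  "lorenz_g \<alpha> \<beta> g0 g1 x y =
     (if x > 0 then g0 (\<bar>x\<bar> powr \<alpha>, y * \<bar>x\<bar> powr \<beta>) else g1 (\<bar>x\<bar> powr \<alpha>, y * \<bar>x\<bar> powr \<beta>))"

definition affine_function :: "('a::real_vector \<Rightarrow> 'b::real_vector) \<Rightarrow> bool" where
  "affine_function h \<longleftrightarrow> (\<exists>l c. linear l \<and> h = (\<lambda>p. l p + c))"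

text \<open>
  The formulas for \<^const>\<open>lorenz_f\<close> and \<^const>\<open>lorenz_g\<close> make sense beyond the section, so two-sided
  derivatives at its boundary coincide with the one-sided ones.  Together with the linear form of
  the field on the cube, \<open>returns\<close> says that the orbit of every point of the section off the stable
  leaf comes back, in bounded time after the exit and without meeting the cube in between; hence
  the first return map is defined on all of \<^const>\<open>lorenz_S_star\<close>.
\<close>

locale geometric_lorenz_flow =
  fixes lam1 lam2 lam3 \<alpha> \<beta> \<theta> b0 b1 :: real
    and g0 g1 :: "real \<times> real \<Rightarrow> real"
    and X :: "real^3 \<Rightarrow> real^3"
    and \<phi> :: "real \<Rightarrow> real^3 \<Rightarrow> real^3"
  assumes eigenvalues: "0 < - lam3" "- lam3 < lam1" "lam1 < - lam2"
    and alpha: "\<alpha> = - lam3 / lam1"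
    and beta: "\<beta> = - lam2 / lam1"
    and C1: "C1_field X"
    and flow: "is_flow_of X \<phi>"
    and linear_in_cube:
      "\<And>p. p \<in> cube \<Longrightarrow> X p = vector [lam1 * p $ 1, lam2 * p $ 2, lam3 * p $ 3]"
    and transverse: "\<And>p. p \<in> lorenz_S \<Longrightarrow> X p $ 3 \<noteq> 0"
    and returns:
      "\<exists>T. \<forall>x\<in>lorenz_I - {0}. \<forall>y\<in>lorenz_I. \<exists>s. 0 < s \<and> s \<le> T \<and>
         \<phi> s (exit_point \<alpha> \<beta> x y) \<in> lorenz_S \<and>
         (\<forall>r. 0 < r \<and> r < s \<longrightarrow> \<phi> r (exit_point \<alpha> \<beta> x y) \<notin> cube)"
    and poincare_form:
      "\<And>x y. x \<in> lorenz_I - {0} \<Longrightarrow> y \<in> lorenz_I \<Longrightarrow>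
         poincare_map \<phi> lorenz_S (section_point x y)
         = section_point (lorenz_f \<alpha> \<theta> b0 b1 x) (lorenz_g \<alpha> \<beta> g0 g1 x y)"
    and f_range: "\<And>x. x \<in> lorenz_I - {0} \<Longrightarrow> lorenz_f \<alpha> \<theta> b0 b1 x \<in> lorenz_I"
    and f_left: "(lorenz_f \<alpha> \<theta> b0 b1 \<longlongrightarrow> 1/2) (at_left 0)"
    and f_right: "(lorenz_f \<alpha> \<theta> b0 b1 \<longlongrightarrow> - 1/2) (at_right 0)"
    and f_expanding: "\<And>x. x \<in> lorenz_I - {0} \<Longrightarrow> deriv (lorenz_f \<alpha> \<theta> b0 b1) x > sqrt 2"
    and f_deriv_left: "filterlim (deriv (lorenz_f \<alpha> \<theta> b0 b1)) at_top (at_left 0)"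
    and f_deriv_right: "filterlim (deriv (lorenz_f \<alpha> \<theta> b0 b1)) at_top (at_right 0)"
    and f_ends: "lorenz_f \<alpha> \<theta> b0 b1 (- 1/2) \<noteq> - 1/2" "lorenz_f \<alpha> \<theta> b0 b1 (1/2) \<noteq> 1/2"
    and g_affine: "affine_function g0" "affine_function g1"
    and g_range:
      "\<And>x y. x \<in> lorenz_I - {0} \<Longrightarrow> y \<in> lorenz_I \<Longrightarrow> lorenz_g \<alpha> \<beta> g0 g1 x y \<in> lorenz_I"
    and g_dy:
      "\<exists>c. 0 < c \<and> c < 1 \<and>
         (\<forall>x\<in>lorenz_I - {0}. \<forall>y\<in>lorenz_I.
            \<bar>deriv (\<lambda>v. lorenz_g \<alpha> \<beta> g0 g1 x v) y\<bar> = \<bar>x\<bar> powr \<beta> \<and> \<bar>x\<bar> powr \<beta> < c)"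
    and g_dx:
      "\<exists>M. \<forall>x\<in>lorenz_I - {0}. \<forall>y\<in>lorenz_I.
         \<bar>deriv (\<lambda>u. lorenz_g \<alpha> \<beta> g0 g1 u y) x\<bar> \<le> M"

text \<open>
  \<open>poincare_image \<phi> i\<close> is the image of \<^const>\<open>lorenz_S_star\<close> under the \<open>i\<close>-th iterate of the Poincare
  map, taken on those points for which the first \<open>i\<close> iterates are defined.
\<close>

primrec poincare_image :: "(real \<Rightarrow> real^3 \<Rightarrow> real^3) \<Rightarrow> nat \<Rightarrow> (real^3) set" where
  "poincare_image \<phi> 0 = lorenz_S_star"
| "poincare_image \<phi> (Suc i) = poincare_map \<phi> lorenz_S ` (poincare_image \<phi> i \<inter> lorenz_S_star)"

definition Lambda_P :: "(real \<Rightarrow> real^3 \<Rightarrow> real^3) \<Rightarrow> (real^3) set" where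
  "Lambda_P \<phi> = closure (\<Inter>i\<in>{1..}. poincare_image \<phi> i)"

definition lorenz_attractor :: "(real \<Rightarrow> real^3 \<Rightarrow> real^3) \<Rightarrow> (real^3) set" where
  "lorenz_attractor \<phi> = (\<Union>t. \<phi> t ` Lambda_P \<phi>) \<union> {0}"

end

theory Submission
  imports Defs
begin

text \<open>
  The limits at \<open>0\<close> force \<open>f\<close> to be odd, and boundedness of \<open>\<partial>\<^sub>xg\<close> forces
  \<open>g(x, y) = c\<^sub>\<plusminus> \<plusminus> y|x|\<^sup>\<beta>\<close>.  The slope bound \<open>\<surd>2\<close> puts a point \<open>p\<close> of the orbit \<open>{p, -p}\<close> of period two
  into the range where every \<open>x\<close> has two preimages, so near \<open>{p, -p}\<close> one can pull back along two
  different words for ever while staying away from \<open>0\<close>.  Hence every \<open>x\<close> in an interval around \<open>p\<close>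
  has a family of backward orbits coded by binary sequences, and each of them yields a point
  \<open>(x, y)\<close> of \<open>\<Lambda>\<^sub>P\<close>.  Injectivity of the Poincare map makes the two preimage strips disjoint, so
  orbits first differing at step \<open>k\<close> give heights \<open>y\<close> at distance at least a constant times
  \<open>\<rho>\<^sup>k\<close>; and \<open>y\<close> depends on \<open>x\<close> in a Lipschitz way.  Together with the flow time this
  parametrizes a part of \<open>\<Lambda>\<close> by a box in \<open>\<real>\<^sup>3\<close> such that the inverse is Lipschitz in two
  coordinates and Hoelder of exponent \<open>1/K\<close> in the third, and the mass distribution principle gives
  dimension at least \<open>2 + 1/K\<close>.
\<close>

section \<open>Mass distribution principle\<close>

text \<open>For \<open>s < \<sigma>\<close>, diameters at most 1 satisfy
  \<open>D powr \<sigma> \<le> D powr s\<close>, so any cover of \<open>A\<close> by such sets has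
  \<open>s\<close>-gauge sum at least \<open>1 / C\<close> times the mass of \<open>V\<close>, and
  the \<open>s\<close>-measure cannot vanish. Bounding a measurable superset \<open>B\<close> of the
  parameters of \<open>U\<close> accommodates an arbitrary map \<open>\<Psi>\<close>.\<close>

lemma hausdorff_dim_ge_mass:
  fixes \<Psi> :: "'b \<Rightarrow> 'a::metric_space" and M :: "'b measure"
  assumes "0 < C"
    and V: "V \<in> sets M" "emeasure M V > 0"
    and sub: "\<Psi> ` V \<subseteq> A"
    and mass: "\<And>U. U \<noteq> {} \<Longrightarrow> bounded U \<Longrightarrow> diameter U \<le> 1 \<Longrightarrow>
      \<exists>B\<in>sets M. {v \<in> V. \<Psi> v \<in> U} \<subseteq> B \<and> emeasure M B \<le> ennreal (C * diameter U powr \<sigma>)"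
  shows "ennreal \<sigma> \<le> hausdorff_dim A"
proof -
  have "\<sigma> \<le> s" if s: "0 \<le> s" "hausdorff_measure s A = 0" for s
  proof (rule ccontr)
    assume "\<not> \<sigma> \<le> s"
    have cover: "ennreal (1 / C) * emeasure M V \<le> (\<Sum>i. hausdorff_gauge s (U i))"
      if cov: "A \<subseteq> (\<Union>i. U i)" and U: "\<And>i. bounded (U i) \<and> diameter (U i) \<le> 1"
      for U :: "nat \<Rightarrow> 'a set"
    proof -
      have "\<exists>B\<in>sets M. {v \<in> V. \<Psi> v \<in> U i} \<subseteq> B
          \<and> emeasure M B \<le> ennreal C * hausdorff_gauge s (U i)" for i
      proof (cases "U i = {}")
        case True
        then show ?thesis by (intro bexI[of _ "{}"]) auto
      next
        case False
        have d: "0 \<le> diameter (U i)" "diameter (U i) \<le> 1"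
          using U diameter_ge_0 by auto
        have "ennreal (diameter (U i) powr \<sigma>) \<le> hausdorff_gauge s (U i)"
        proof (cases "s = 0")
          case True
          then show ?thesis
            using False d \<open>\<not> \<sigma> \<le> s\<close> by (simp add: hausdorff_gauge_def powr_le1)
        next
          case neq: False
          \<comment> \<open>For diameter 0 both sides are 0, because
            \<open>0 powr a = 0\<close>.\<close>
          have "diameter (U i) powr \<sigma> \<le> diameter (U i) powr s"
            using d \<open>\<not> \<sigma> \<le> s\<close> by (cases "diameter (U i) = 0") (auto intro: powr_mono')
          then show ?thesis
            using False neq by (simp add: hausdorff_gauge_def ennreal_leI)
        qed
        then have "ennreal (C * diameter (U i) powr \<sigma>) \<le> ennreal C * hausdorff_gauge s (U i)"
          using \<open>0 < C\<close> by (simp add: ennreal_mult mult_left_mono)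
        then show ?thesis
          using mass[of "U i"] False U[of i] by (meson order_trans)
      qed
      then obtain B where B: "\<And>i. B i \<in> sets M" "\<And>i. {v \<in> V. \<Psi> v \<in> U i} \<subseteq> B i"
        "\<And>i. emeasure M (B i) \<le> ennreal C * hausdorff_gauge s (U i)"
        by metis
      have "V \<subseteq> (\<Union>i. B i)"
        using cov sub B(2) by blast
      then have "emeasure M V \<le> emeasure M (\<Union>i. B i)"
        using B(1) by (intro emeasure_mono) auto
      also have "\<dots> \<le> (\<Sum>i. emeasure M (B i))"
        using B(1) by (intro emeasure_subadditive_countably) auto
      also have "\<dots> \<le> (\<Sum>i. ennreal C * hausdorff_gauge s (U i))"
        by (intro suminf_le B(3)) auto
      also have "\<dots> = ennreal C * (\<Sum>i. hausdorff_gauge s (U i))"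
        by simp
      finally have "ennreal (1 / C) * emeasure M V
          \<le> ennreal (1 / C) * (ennreal C * (\<Sum>i. hausdorff_gauge s (U i)))"
        by (rule mult_left_mono) simp
      also have "\<dots> = (\<Sum>i. hausdorff_gauge s (U i))"
        using \<open>0 < C\<close> by (simp flip: mult.assoc ennreal_mult)
      finally show ?thesis .
    qed
    \<comment> \<open>The single scale 1 suffices, the measure being the supremum over all
      scales.\<close>
    have "ennreal (1 / C) * emeasure M V \<le> hausdorff_premeasure s 1 A"
      unfolding hausdorff_premeasure_def by (intro INF_greatest) (auto intro: cover)
    also have "\<dots> \<le> hausdorff_measure s A"
      unfolding hausdorff_measure_def by (intro SUP_upper) auto
    finally show False
      using s V(2) \<open>0 < C\<close> by simp
  qed
  then show ?thesis
    unfolding hausdorff_dim_def by (intro INF_greatest ennreal_leI) auto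
qed

section \<open>The flow near the section\<close>

lemma C1_field_lipschitz:
  fixes X :: "'a::euclidean_space \<Rightarrow> 'a"
  assumes "C1_field X" and "compact K" "convex K"
  obtains L where "\<And>p q. p \<in> K \<Longrightarrow> q \<in> K \<Longrightarrow> norm (X p - X q) \<le> L * norm (p - q)"
proof -
  obtain D :: "'a \<Rightarrow> 'a \<Rightarrow>\<^sub>L 'a" where
    D: "\<And>p. (X has_derivative blinfun_apply (D p)) (at p)" and cD: "continuous_on UNIV D"
    using assms(1) unfolding C1_field_def by blast
  have "compact (D ` K)"
    by (intro compact_continuous_image continuous_on_subset[OF cD] assms) auto
  then obtain L where "\<And>p. p \<in> K \<Longrightarrow> norm (D p) \<le> L"
    by (meson bounded_iff compact_imp_bounded imageI)
  then have "norm (X p - X q) \<le> L * norm (p - q)" if "p \<in> K" "q \<in> K" for p q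
    using that D
    by (intro differentiable_bound[OF \<open>convex K\<close>, of X "\<lambda>p. blinfun_apply (D p)"])
       (auto simp: norm_blinfun.rep_eq[symmetric] intro: has_derivative_at_withinI)
  then show ?thesis using that by blast
qed

text \<open>Gronwall argument: with \<open>L\<close> a Lipschitz constant on a ball containing both
  curves, the squared distance weighted by \<open>exp (- (2 * L * s))\<close> is nonincreasing and
  starts at 0.\<close>

lemma C1_field_unique_solution:
  fixes X :: "'a::euclidean_space \<Rightarrow> 'a"
  assumes "C1_field X"
    and u: "\<And>t. t \<in> {0..T} \<Longrightarrow> (u has_vector_derivative X (u t)) (at t)"
    and v: "\<And>t. t \<in> {0..T} \<Longrightarrow> (v has_vector_derivative X (v t)) (at t)"
    and "u 0 = v 0" and t: "t \<in> {0..T}"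
  shows "u t = v t"
proof -
  have "continuous_on {0..T} u" "continuous_on {0..T} v"
    using u v by (meson continuous_at_imp_continuous_on has_vector_derivative_continuous)+
  then have "bounded (u ` {0..T} \<union> v ` {0..T})"
    by (simp add: compact_continuous_image compact_imp_bounded)
  then obtain e where e: "u ` {0..T} \<union> v ` {0..T} \<subseteq> cball 0 e"
    by (meson ball_subset_cball bounded_subset_ballD order_trans)
  obtain L where L: "\<And>p q. p \<in> cball 0 e \<Longrightarrow> q \<in> cball 0 e \<Longrightarrow> norm (X p - X q) \<le> L * norm (p - q)"
    using C1_field_lipschitz[OF assms(1), of "cball 0 e"] by auto
  define w where "w = (\<lambda>s. (u s - v s) \<bullet> (u s - v s) * exp (- (2 * L * s)))"
  have "w t \<le> w 0"
  proof (rule DERIV_nonpos_imp_nonincreasing[of 0 t w])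
    show "0 \<le> t" using t by simp
    fix s assume s: "0 \<le> s" "s \<le> t"
    then have sT: "s \<in> {0..T}" using t by simp
    let ?d = "u s - v s"
    let ?D = "2 * (?d \<bullet> (X (u s) - X (v s)) - L * (?d \<bullet> ?d)) * exp (- (2 * L * s))"
    have du: "((\<lambda>s. u s - v s) has_derivative (\<lambda>h. h *\<^sub>R (X (u s) - X (v s)))) (at s)"
      using has_vector_derivative_diff[OF u[OF sT] v[OF sT]] by (simp add: has_vector_derivative_def)
    have "((\<lambda>s. (u s - v s) \<bullet> (u s - v s)) has_derivative
        (\<lambda>h. ?d \<bullet> (h *\<^sub>R (X (u s) - X (v s))) + (h *\<^sub>R (X (u s) - X (v s))) \<bullet> ?d)) (at s)"
      by (intro has_derivative_inner du)
    then have "((\<lambda>s. (u s - v s) \<bullet> (u s - v s)) has_field_derivative 2 * (?d \<bullet> (X (u s) - X (v s)))) (at s)"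
      unfolding has_field_derivative_def
      by (rule has_derivative_eq_rhs) (auto simp: fun_eq_iff inner_commute algebra_simps)
    moreover have "((\<lambda>s. exp (- (2 * L * s))) has_field_derivative - (2 * L) * exp (- (2 * L * s))) (at s)"
      by (auto intro!: derivative_eq_intros)
    ultimately have "(w has_field_derivative ?D) (at s)"
      unfolding w_def by (rule DERIV_mult[THEN DERIV_cong]) (simp add: algebra_simps)
    moreover have "?d \<bullet> (X (u s) - X (v s)) \<le> L * (?d \<bullet> ?d)"
    proof -
      have "?d \<bullet> (X (u s) - X (v s)) \<le> norm ?d * norm (X (u s) - X (v s))"
        by (rule norm_cauchy_schwarz)
      also have "\<dots> \<le> norm ?d * (L * norm ?d)"
        using e sT by (intro mult_left_mono L) (auto simp: image_subset_iff)
      finally show ?thesis by (simp add: dot_square_norm power2_eq_square algebra_simps)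
    qed
    then have "?D \<le> 0" by (simp add: mult_le_0_iff)
    ultimately show "\<exists>y. (w has_field_derivative y) (at s) \<and> y \<le> 0" by blast
  qed
  then have "(u t - v t) \<bullet> (u t - v t) * exp (- (2 * L * t)) \<le> 0"
    using \<open>u 0 = v 0\<close> by (simp add: w_def)
  then have "(u t - v t) \<bullet> (u t - v t) \<le> 0"
    by (simp add: mult_le_0_iff)
  then have "(u t - v t) \<bullet> (u t - v t) = 0"
    using inner_ge_zero[of "u t - v t"] by linarith
  then show ?thesis by simp
qed

lemma section_point_nth [simp]:
  "section_point x y $ 1 = x" "section_point x y $ 2 = y" "section_point x y $ 3 = 1"
  by (simp_all add: section_point_def)

lemma section_point_mem_S_iff [simp]:
  "section_point x y \<in> lorenz_S \<longleftrightarrow> x \<in> lorenz_I \<and> y \<in> lorenz_I"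
  unfolding lorenz_S_def by (auto simp: section_point_def vec_eq_iff forall_3)

lemma section_point_mem_S_star_iff:
  "section_point x y \<in> lorenz_S_star \<longleftrightarrow> x \<in> lorenz_I - {0} \<and> y \<in> lorenz_I"
  unfolding lorenz_S_star_def lorenz_Gamma_def by auto

section \<open>Recovering times and coordinates from exponentials\<close>

lemma exp_difference_upper:
  fixes a t t' \<tau> :: real
  assumes "t \<in> {0..\<tau>}" "t' \<in> {0..\<tau>}"
  shows "\<bar>exp (a * t) - exp (a * t')\<bar> \<le> \<bar>a\<bar> * exp (\<bar>a\<bar> * \<tau>) * \<bar>t - t'\<bar>"
proof -
  have *: "exp u - exp v \<le> exp (\<bar>a\<bar> * \<tau>) * (\<bar>a\<bar> * \<bar>t - t'\<bar>)"
    if "u \<le> \<bar>a\<bar> * \<tau>" "\<bar>u - v\<bar> = \<bar>a\<bar> * \<bar>t - t'\<bar>" for u v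
  proof -
    have "exp u * (1 + (v - u)) \<le> exp u * exp (v - u)"
      using exp_ge_add_one_self[of "v - u"] by (intro mult_left_mono) auto
    then have "exp u - exp v \<le> exp u * (u - v)"
      by (simp add: exp_diff algebra_simps)
    also have "\<dots> \<le> exp u * (\<bar>a\<bar> * \<bar>t - t'\<bar>)"
      using that(2) abs_ge_self[of "u - v"] by (intro mult_left_mono) auto
    also have "\<dots> \<le> exp (\<bar>a\<bar> * \<tau>) * (\<bar>a\<bar> * \<bar>t - t'\<bar>)"
      using that(1) by (intro mult_right_mono) auto
    finally show ?thesis .
  qed
  have le: "a * s \<le> \<bar>a\<bar> * \<tau>" if "s \<in> {0..\<tau>}" for s
    using that by (intro mult_mono) auto
  have eq: "\<bar>a * t - a * t'\<bar> = \<bar>a\<bar> * \<bar>t - t'\<bar>" "\<bar>a * t' - a * t\<bar> = \<bar>a\<bar> * \<bar>t - t'\<bar>"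
    by (simp_all add: abs_mult abs_minus_commute flip: right_diff_distrib)
  show ?thesis
    using *[OF le[OF assms(1)] eq(1)] *[OF le[OF assms(2)] eq(2)] by (simp add: abs_le_iff mult_ac)
qed

text \<open>The factor \<open>exp (a * t)\<close> is bounded below on the time interval, so dividing
  by it recovers \<open>u\<close>. The error from using two different times is of order
  \<open>\<bar>t - t'\<bar>\<close>, as \<open>\<bar>u'\<bar> \<le> 1\<close>.\<close>

lemma exp_scaled_difference:
  fixes a \<tau> :: real
  shows "\<exists>C>0. \<forall>t\<in>{0..\<tau>}. \<forall>t'\<in>{0..\<tau>}. \<forall>u u'. \<bar>u'\<bar> \<le> 1 \<longrightarrow>
    \<bar>u - u'\<bar> \<le> C * (\<bar>u * exp (a * t) - u' * exp (a * t')\<bar> + \<bar>t - t'\<bar>)"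
proof -
  define E where "E = exp (\<bar>a\<bar> * \<tau>)"
  have "\<bar>u - u'\<bar> \<le> E * (1 + \<bar>a\<bar> * E) * (\<bar>u * exp (a * t) - u' * exp (a * t')\<bar> + \<bar>t - t'\<bar>)"
    if t: "t \<in> {0..\<tau>}" "t' \<in> {0..\<tau>}" and u: "\<bar>u'\<bar> \<le> 1" for t t' u u'
  proof -
    let ?q = "\<bar>u * exp (a * t) - u' * exp (a * t')\<bar>"
    have "- a * t \<le> \<bar>a\<bar> * \<tau>" using t by (intro mult_mono) auto
    then have E: "1 \<le> E * exp (a * t)" by (simp add: E_def flip: exp_add)
    have "\<bar>u - u'\<bar> * exp (a * t) = \<bar>(u * exp (a * t) - u' * exp (a * t')) + u' * (exp (a * t') - exp (a * t))\<bar>"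
    proof -
      have "\<bar>u - u'\<bar> * exp (a * t) = \<bar>(u - u') * exp (a * t)\<bar>" by (simp add: abs_mult)
      then show ?thesis by (simp add: algebra_simps)
    qed
    also have "\<dots> \<le> ?q + \<bar>u'\<bar> * \<bar>exp (a * t') - exp (a * t)\<bar>"
      using abs_triangle_ineq by (simp flip: abs_mult)
    also have "\<bar>u'\<bar> * \<bar>exp (a * t') - exp (a * t)\<bar> \<le> 1 * (\<bar>a\<bar> * E * \<bar>t' - t\<bar>)"
      using u exp_difference_upper[OF t(2,1), of a] unfolding E_def by (intro mult_mono) auto
    finally have 1: "\<bar>u - u'\<bar> * exp (a * t) \<le> ?q + \<bar>a\<bar> * E * \<bar>t - t'\<bar>"
      by (simp add: abs_minus_commute)
    have "\<bar>u - u'\<bar> * 1 \<le> \<bar>u - u'\<bar> * (E * exp (a * t))"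
      using E by (rule mult_left_mono) simp
    also have "\<dots> = E * (\<bar>u - u'\<bar> * exp (a * t))" by simp
    also have "\<dots> \<le> E * (?q + \<bar>a\<bar> * E * \<bar>t - t'\<bar>)"
      using 1 by (rule mult_left_mono) (simp add: E_def)
    also have "\<dots> \<le> E * ((1 + \<bar>a\<bar> * E) * (?q + \<bar>t - t'\<bar>))"
      by (rule mult_left_mono) (simp_all add: E_def algebra_simps)
    finally show ?thesis by (simp only: mult.assoc mult_1_right)
  qed
  moreover have "0 < E * (1 + \<bar>a\<bar> * E)" by (simp add: E_def add_pos_nonneg)
  ultimately show ?thesis by blast
qed

text \<open>The logarithm is Lipschitz away from 0, and for \<open>a < 0\<close> the smallest value
  of \<open>exp (a * t)\<close> on the interval is \<open>exp (a * \<tau>)\<close>.\<close>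

lemma exp_difference_lower:
  fixes a \<tau> :: real
  assumes "a < 0"
  shows "\<exists>C>0. \<forall>t\<in>{0..\<tau>}. \<forall>t'\<in>{0..\<tau>}. \<bar>t - t'\<bar> \<le> C * \<bar>exp (a * t) - exp (a * t')\<bar>"
proof -
  define C where "C = 1 / (- a * exp (a * \<tau>))"
  have *: "t' - t \<le> C * \<bar>exp (a * t) - exp (a * t')\<bar>" if t: "t \<le> \<tau>" "t' \<le> \<tau>" for t t'
  proof -
    have "- a * (t' - t) = ln (exp (a * t)) - ln (exp (a * t'))" by (simp add: algebra_simps)
    also have "\<dots> \<le> (exp (a * t) - exp (a * t')) / exp (a * t')" by (rule ln_diff_le) auto
    also have "\<dots> \<le> \<bar>exp (a * t) - exp (a * t')\<bar> / exp (a * t')"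
      by (intro divide_right_mono) auto
    also have "\<dots> \<le> \<bar>exp (a * t) - exp (a * t')\<bar> / exp (a * \<tau>)"
      using t assms by (intro divide_left_mono) (auto simp: mult_left_mono_neg)
    finally have "t' - t \<le> \<bar>exp (a * t) - exp (a * t')\<bar> / exp (a * \<tau>) / (- a)"
      using assms by (subst pos_le_divide_eq) (auto simp: mult.commute)
    then show ?thesis by (simp add: C_def mult.commute)
  qed
  have "\<bar>t - t'\<bar> \<le> C * \<bar>exp (a * t) - exp (a * t')\<bar>" if "t \<in> {0..\<tau>}" "t' \<in> {0..\<tau>}" for t t'
    using *[of t t'] *[of t' t] that by (simp add: abs_le_iff abs_minus_commute)
  moreover have "0 < C" using assms by (simp add: C_def mult_neg_pos)
  ultimately show ?thesis by blast
qed

section \<open>Orbits inside the cube and injectivity of the Poincare map\<close>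

context geometric_lorenz_flow
begin

lemma lam_signs: "0 < lam1" "lam2 < 0" "lam3 < 0"
  using eigenvalues by auto

lemma flow_zero [simp]: "\<phi> 0 p = p"
  and flow_add: "\<phi> (s + t) p = \<phi> s (\<phi> t p)"
  and flow_deriv: "((\<lambda>s. \<phi> s p) has_vector_derivative X (\<phi> t p)) (at t)"
  using flow by (auto simp: is_flow_of_def)

text \<open>The linear curve stays in the cube as long as its first coordinate does, since the other
  two are contracted. There it solves the equation of the flow, and uniqueness identifies it with
  the orbit.\<close>

lemma flow_linear:
  assumes "0 \<le> t" and x: "\<bar>x\<bar> * exp (lam1 * t) \<le> 1" and y: "\<bar>y\<bar> \<le> 1"
  shows "\<phi> t (section_point x y) = vector [x * exp (lam1 * t), y * exp (lam2 * t), exp (lam3 * t)]"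
proof -
  \<comment> \<open>Written in basis vectors so that the derivative can be taken term by
    term.\<close>
  define c where "c = (\<lambda>s. (x * exp (lam1 * s)) *\<^sub>R axis 1 1 + (y * exp (lam2 * s)) *\<^sub>R axis 2 1
    + exp (lam3 * s) *\<^sub>R axis 3 (1::real) :: real^3)"
  have c: "c s = vector [x * exp (lam1 * s), y * exp (lam2 * s), exp (lam3 * s)]" for s
    by (simp add: c_def vec_eq_iff forall_3 axis_def)
  have "\<phi> t (section_point x y) = c t"
  proof (rule C1_field_unique_solution[OF C1, where T = t])
    fix s assume s: "s \<in> {0..t}"
    show "((\<lambda>s. \<phi> s (section_point x y)) has_vector_derivative X (\<phi> s (section_point x y))) (at s)"
      by (rule flow_deriv)
    have "exp (lam1 * s) \<le> exp (lam1 * t)" "exp (lam2 * s) \<le> 1" "exp (lam3 * s) \<le> 1"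
      using s lam_signs by (auto simp: mult_nonpos_nonneg)
    then have "\<bar>x\<bar> * exp (lam1 * s) \<le> 1" "\<bar>y\<bar> * exp (lam2 * s) \<le> 1" "exp (lam3 * s) \<le> 1"
      using x y mult_left_mono[of "exp (lam1 * s)" "exp (lam1 * t)" "\<bar>x\<bar>"]
      by (auto intro: order_trans mult_le_one)
    then have "c s \<in> cube"
      by (simp add: c cube_def forall_3 abs_mult)
    then have "X (c s) = (x * (lam1 * exp (lam1 * s))) *\<^sub>R axis 1 1 
        + (y * (lam2 * exp (lam2 * s))) *\<^sub>R axis 2 1 + (lam3 * exp (lam3 * s)) *\<^sub>R axis 3 1"
      by (simp add: linear_in_cube) (simp add: c vec_eq_iff forall_3 axis_def)
    then show "(c has_vector_derivative X (c s)) (at s)"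
      unfolding c_def by (auto intro!: derivative_eq_intros simp: has_real_derivative_iff_has_vector_derivative[symmetric] mult_ac)
  qed (use \<open>0 \<le> t\<close> in \<open>auto simp: c vec_eq_iff forall_3\<close>)
  then show ?thesis by (simp add: c)
qed

lemma alpha_bounds: "0 < \<alpha>" "\<alpha> < 1" and beta_gt_1: "1 < \<beta>"
  using eigenvalues by (auto simp: alpha beta divide_simps)

lemma lorenz_I_iff: "x \<in> lorenz_I \<longleftrightarrow> \<bar>x\<bar> \<le> 1/2"
  by (auto simp: lorenz_I_def)

text \<open>The time in which the first coordinate doubles: until then every orbit that starts in
  \<open>lorenz_S\<close> is still in the cube.\<close>

definition return_lower:: real where
  "return_lower = ln 2 / lam1"

lemma return_lower_pos: "0 < return_lower"
  using lam_signs by (simp add: return_lower_def)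

lemma flow_linear_until_return_lower:
  assumes "x \<in> lorenz_I" "y \<in> lorenz_I" "0 \<le> t" "t \<le> return_lower"
  shows "\<phi> t (section_point x y) = vector [x * exp (lam1 * t), y * exp (lam2 * t), exp (lam3 * t)]"
proof (rule flow_linear)
  have "exp (lam1 * t) \<le> exp (ln 2)"
    using assms lam_signs by (subst exp_le_cancel_iff) (simp add: return_lower_def field_simps)
  then show "\<bar>x\<bar> * exp (lam1 * t) \<le> 1"
    using assms(1) mult_mono[of "\<bar>x\<bar>" "1/2" "exp (lam1 * t)" 2] by (simp add: lorenz_I_iff)
qed (use assms in \<open>auto simp: lorenz_I_iff\<close>)

text \<open>At positive times before \<open>return_lower\<close> the third coordinate is
  \<open>exp (lam3 * t) < 1\<close>, whereas the section lies at height 1.\<close>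

lemma return_time_ge:
  assumes x: "x \<in> lorenz_I - {0}" and y: "y \<in> lorenz_I"
  shows "return_lower \<le> return_time \<phi> lorenz_S (section_point x y)"
  unfolding return_time_def
proof (rule cInf_greatest)
  let ?R = "{t. 0 < t \<and> \<phi> t (section_point x y) \<in> lorenz_S}"
  \<comment> \<open>The exit time, at which the first coordinate has grown to modulus 1. Continuing
    from the exit point shows that the set of return times is nonempty, without which its
    \<open>Inf\<close> would carry no information.\<close>
  define T where "T = - ln \<bar>x\<bar> / lam1"
  have x': "0 < \<bar>x\<bar>" "\<bar>x\<bar> \<le> 1/2" using x by (auto simp: lorenz_I_iff)
  have T: "0 \<le> T" using x' lam_signs by (simp add: T_def divide_nonpos_pos)
  have e: "exp (lam1 * T) = 1 / \<bar>x\<bar>"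
    using x' lam_signs by (simp add: T_def exp_minus inverse_eq_divide)
  have "\<phi> T (section_point x y) = vector [x * exp (lam1 * T), y * exp (lam2 * T), exp (lam3 * T)]"
    using T e x' y by (intro flow_linear) (auto simp: lorenz_I_iff)
  moreover have "x * exp (lam1 * T) = sgn x" using x' by (simp add: e sgn_if)
  moreover have "exp (lam2 * T) = \<bar>x\<bar> powr \<beta>" "exp (lam3 * T) = \<bar>x\<bar> powr \<alpha>"
    using x' by (simp_all add: powr_def alpha beta T_def)
  ultimately have exit: "\<phi> T (section_point x y) = exit_point \<alpha> \<beta> x y"
    by (simp add: exit_point_def)
  obtain s where "0 < s" "\<phi> s (exit_point \<alpha> \<beta> x y) \<in> lorenz_S"
    using returns x y by blast
  then have "s + T \<in> ?R"
    using T exit by (simp add: flow_add)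
  then show "?R \<noteq> {}" by blast
  fix t assume t: "t \<in> ?R"
  show "return_lower \<le> t"
  proof (rule ccontr)
    assume "\<not> return_lower \<le> t"
    then have "\<phi> t (section_point x y) $ 3 = exp (lam3 * t)"
      using flow_linear_until_return_lower[of x y t] x y t by simp
    moreover have "exp (lam3 * t) < 1" using t lam_signs by (simp add: mult_neg_pos)
    ultimately show False using t by (auto simp: lorenz_S_def)
  qed
qed

text \<open>If two points have the same image, the one with the longer return time meets the other
  after the difference of the two times. This would be an earlier return, since the shorter return
  time is positive.\<close>

lemma poincare_map_inj:
  assumes p: "p \<in> lorenz_S_star" and q: "q \<in> lorenz_S_star"
    and eq: "poincare_map \<phi> lorenz_S p = poincare_map \<phi> lorenz_S q"
  shows "p = q"
proof -
  define \<rho> where "\<rho> = return_time \<phi> lorenz_S"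
  have ge: "return_lower \<le> \<rho> p" if S: "p \<in> lorenz_S_star" for p
  proof -
    obtain x y where "p = section_point x y"
      using S unfolding lorenz_S_star_def lorenz_S_def by blast
    then show ?thesis using return_time_ge S by (simp add: \<rho>_def section_point_mem_S_star_iff)
  qed
  have step: "\<phi> (\<rho> p - \<rho> q) p = q" if "\<phi> (\<rho> p) p = \<phi> (\<rho> q) q" for p q
    using that flow_add[of "- \<rho> q" "\<rho> p" p] flow_add[of "- \<rho> q" "\<rho> q" q] by simp
  have no_less: "\<not> \<rho> q < \<rho> p"
    if "\<phi> (\<rho> p) p = \<phi> (\<rho> q) q" "q \<in> lorenz_S_star" for p q
  proof
    assume "\<rho> q < \<rho> p"
    then have "\<rho> p - \<rho> q \<in> {t. 0 < t \<and> \<phi> t p \<in> lorenz_S}"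
      using step[OF that(1)] that(2) by (simp add: lorenz_S_star_def)
    then have "\<rho> p \<le> \<rho> p - \<rho> q"
      unfolding \<rho>_def return_time_def by (intro cInf_lower bdd_belowI[of _ 0]) auto
    then show False using ge[OF that(2)] return_lower_pos by simp
  qed
  have "\<phi> (\<rho> p) p = \<phi> (\<rho> q) q"
    using eq by (simp add: poincare_map_def \<rho>_def)
  then show "p = q"
    using no_less[of p q] no_less[of q p] p q step[of p q] by simp
qed

text \<open>The third coordinate \<open>exp (lam3 * t)\<close> determines the time; once the time is
  known up to a multiple of \<open>d\<close>, the first two coordinates determine \<open>x\<close>
  and \<open>y\<close>.\<close>

lemma flow_box_coordinates:
  obtains C where "0 < C"
    "\<And>t t' x x' y y'. \<lbrakk>t \<in> {0..return_lower}; t' \<in> {0..return_lower}; x \<in> lorenz_I; x' \<in> lorenz_I;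
        y \<in> lorenz_I; y' \<in> lorenz_I\<rbrakk> \<Longrightarrow>
      (let d = dist (\<phi> t (section_point x y)) (\<phi> t' (section_point x' y'))
       in \<bar>t - t'\<bar> \<le> C * d \<and> \<bar>x - x'\<bar> \<le> C * d \<and> \<bar>y - y'\<bar> \<le> C * d)"
proof -
  obtain C1 where C1: "0 < C1" "\<And>t t' u u'. \<lbrakk>t \<in> {0..return_lower}; t' \<in> {0..return_lower}; \<bar>u'\<bar> \<le> 1\<rbrakk> \<Longrightarrow>
      \<bar>u - u'\<bar> \<le> C1 * (\<bar>u * exp (lam1 * t) - u' * exp (lam1 * t')\<bar> + \<bar>t - t'\<bar>)"
    using exp_scaled_difference[of return_lower lam1] by blast
  obtain C2 where C2: "0 < C2" "\<And>t t' u u'. \<lbrakk>t \<in> {0..return_lower}; t' \<in> {0..return_lower}; \<bar>u'\<bar> \<le> 1\<rbrakk> \<Longrightarrow>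
      \<bar>u - u'\<bar> \<le> C2 * (\<bar>u * exp (lam2 * t) - u' * exp (lam2 * t')\<bar> + \<bar>t - t'\<bar>)"
    using exp_scaled_difference[of return_lower lam2] by blast
  obtain C3 where C3: "0 < C3" "\<And>t t'. \<lbrakk>t \<in> {0..return_lower}; t' \<in> {0..return_lower}\<rbrakk> \<Longrightarrow>
      \<bar>t - t'\<bar> \<le> C3 * \<bar>exp (lam3 * t) - exp (lam3 * t')\<bar>"
    using exp_difference_lower[of lam3 return_lower] lam_signs by blast
  define C where "C = C3 + (C1 + C2) * (1 + C3)"
  have C: "0 < C" "C3 \<le> C" "C1 * (1 + C3) \<le> C" "C2 * (1 + C3) \<le> C"
    using C1(1) C2(1) C3(1) by (auto simp: C_def algebra_simps intro!: add_pos_pos add_nonneg_nonneg)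
  show ?thesis
  proof (rule that[OF C(1)])
    fix t t' x x' y y'
    assume t: "t \<in> {0..return_lower}" "t' \<in> {0..return_lower}"
      and xy: "x \<in> lorenz_I" "x' \<in> lorenz_I" "y \<in> lorenz_I" "y' \<in> lorenz_I"
    define q q' d where q: "q = \<phi> t (section_point x y)" "q' = \<phi> t' (section_point x' y')"
      and d: "d = dist q q'"
    have comp: "\<bar>q $ i - q' $ i\<bar> \<le> d" for i
      using component_le_norm_cart[of "q - q'" i] by (simp add: d dist_norm)
    have q_eq: "q = vector [x * exp (lam1 * t), y * exp (lam2 * t), exp (lam3 * t)]"
      "q' = vector [x' * exp (lam1 * t'), y' * exp (lam2 * t'), exp (lam3 * t')]"
      using t xy by (auto simp: q flow_linear_until_return_lower)
    have "\<bar>exp (lam3 * t) - exp (lam3 * t')\<bar> \<le> d" using comp[of 3] by (simp add: q_eq)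
    then have 3: "\<bar>t - t'\<bar> \<le> C3 * d"
      using C3(2)[OF t] mult_left_mono[of _ d C3] C3(1) by (meson less_imp_le order_trans)
    have "0 \<le> d" by (simp add: d)
    have lift: "\<bar>u - u'\<bar> \<le> C * d"
      if "\<bar>u - u'\<bar> \<le> B * (w + \<bar>t - t'\<bar>)" "w \<le> d" "0 < B" "B * (1 + C3) \<le> C" for u u' w B :: real
    proof -
      have "B * (w + \<bar>t - t'\<bar>) \<le> B * (d + C3 * d)"
        using that 3 by (intro mult_left_mono add_mono) auto
      also have "\<dots> = B * (1 + C3) * d" by (simp add: algebra_simps)
      also have "\<dots> \<le> C * d" using that(4) \<open>0 \<le> d\<close> by (rule mult_right_mono)
      finally show ?thesis using that(1) by linarith
    qed
    have "\<bar>x'\<bar> \<le> 1" "\<bar>y'\<bar> \<le> 1" using xy by (auto simp: lorenz_I_iff)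
    moreover have "\<bar>x * exp (lam1 * t) - x' * exp (lam1 * t')\<bar> \<le> d"
      "\<bar>y * exp (lam2 * t) - y' * exp (lam2 * t')\<bar> \<le> d"
      using comp[of 1] comp[of 2] by (simp_all add: q_eq)
    ultimately have "\<bar>x - x'\<bar> \<le> C * d" "\<bar>y - y'\<bar> \<le> C * d"
      using lift[OF C1(2)[OF t, of x' x] _ C1(1) C(3)] lift[OF C2(2)[OF t, of y' y] _ C2(1) C(4)]
      by blast+
    moreover have "\<bar>t - t'\<bar> \<le> C * d"
      using 3 mult_right_mono[OF C(2) \<open>0 \<le> d\<close>] by linarith
    ultimately show "let d = dist (\<phi> t (section_point x y)) (\<phi> t' (section_point x' y'))
       in \<bar>t - t'\<bar> \<le> C * d \<and> \<bar>x - x'\<bar> \<le> C * d \<and> \<bar>y - y'\<bar> \<le> C * d"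
      by (simp add: Let_def d q)
  qed
qed

end

section \<open>Normal form of the Poincare map\<close>

lemma affine_function_prodE:
  assumes "affine_function (h :: real \<times> real \<Rightarrow> real)"
  obtains a b c where "\<And>u v. h (u, v) = a * u + b * v + c"
proof -
  obtain l c where l: "linear l" and h: "h = (\<lambda>p. l p + c)"
    using assms unfolding affine_function_def by blast
  have "h (u, v) = l (1, 0) * u + l (0, 1) * v + c" for u v
  proof -
    have "(u, v) = u *\<^sub>R (1, 0) + v *\<^sub>R (0, 1)" by simp
    then have "l (u, v) = l (u *\<^sub>R (1, 0) + v *\<^sub>R (0, 1))" by simp
    also have "\<dots> = u * l (1, 0) + v * l (0, 1)"
      using l by (simp only: linear_add linear_scale real_scaleR_def)
    finally show ?thesis by (simp add: h algebra_simps)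
  qed
  then show ?thesis using that by blast
qed

lemma DERIV_abs_powr:
  fixes x :: real
  assumes "x \<noteq> 0"
  shows "((\<lambda>x. \<bar>x\<bar> powr a) has_real_derivative (sgn x * (a * \<bar>x\<bar> powr (a - 1)))) (at x)"
proof (cases "0 < x")
  case True
  then have "((\<lambda>x. x powr a) has_real_derivative (sgn x * (a * \<bar>x\<bar> powr (a - 1)))) (at x)"
    using has_real_derivative_powr[OF True, of a] by simp
  then show ?thesis
    by (rule has_field_derivative_transform_within_open[of _ _ _ "{0<..}"]) (use True in auto)
next
  case False
  then have "((\<lambda>x. (- x) powr a) has_real_derivative (a * (- x) powr (a - 1) * (- 1))) (at x)"
    using assms by (intro DERIV_chain2[of "\<lambda>x. x powr a"] has_real_derivative_powr)
      (auto intro!: derivative_eq_intros)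
  then have "((\<lambda>x. (- x) powr a) has_real_derivative (sgn x * (a * \<bar>x\<bar> powr (a - 1)))) (at x)"
    using False assms by simp
  then show ?thesis
    by (rule has_field_derivative_transform_within_open[of _ _ _ "{..<0}"]) (use False assms in auto)
qed

text \<open>For \<open>\<alpha> < 1\<close> the derivative of
  \<open>\<bar>u\<bar> powr \<alpha>\<close> blows up at 0, so only the coefficient 0 is compatible
  with a bound.\<close>

lemma affine_abs_powr_deriv_bounded:
  fixes a M \<alpha> \<sigma> :: real
  assumes "0 < \<alpha>" "\<alpha> < 1" "\<bar>\<sigma>\<bar> = 1"
    and "\<And>x. 0 < x \<Longrightarrow> x \<le> 1/2 \<Longrightarrow> \<bar>deriv (\<lambda>u. a * \<bar>u\<bar> powr \<alpha> + c) (\<sigma> * x)\<bar> \<le> M"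
  shows "a = 0"
proof (rule ccontr)
  assume "a \<noteq> 0"
  define K where "K = \<bar>M\<bar> / (\<bar>a\<bar> * \<alpha>) + 1"
  define x where "x = (1/2) * K powr (1 / (\<alpha> - 1))"
  have K: "1 \<le> K" using \<open>0 < \<alpha>\<close> by (simp add: K_def)
  have "K powr (1 / (\<alpha> - 1)) \<le> K powr 0"
    using K \<open>\<alpha> < 1\<close> by (intro powr_mono) auto
  then have x: "0 < x" "x \<le> 1/2"
    using K by (auto simp: x_def)
  have "x powr (\<alpha> - 1) = (1/2) powr (\<alpha> - 1) * K"
    using K \<open>\<alpha> < 1\<close> unfolding x_def by (subst powr_mult) (auto simp: powr_powr)
  moreover have "1 \<le> (1/2::real) powr (\<alpha> - 1)"
    using powr_mono'[of "\<alpha> - 1" 0 "1/2::real"] \<open>\<alpha> < 1\<close> by simp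
  ultimately have "K \<le> x powr (\<alpha> - 1)"
    using K mult_right_mono[of 1 "(1/2) powr (\<alpha> - 1)" K] by simp
  then have "\<bar>a\<bar> * \<alpha> * K \<le> \<bar>a\<bar> * \<alpha> * x powr (\<alpha> - 1)"
    using \<open>0 < \<alpha>\<close> by (intro mult_left_mono) auto
  moreover have "\<bar>a\<bar> * \<alpha> * K = \<bar>M\<bar> + \<bar>a\<bar> * \<alpha>"
    using \<open>a \<noteq> 0\<close> \<open>0 < \<alpha>\<close> by (simp add: K_def field_simps)
  moreover have "deriv (\<lambda>u. a * \<bar>u\<bar> powr \<alpha> + c) (\<sigma> * x)
      = a * (sgn (\<sigma> * x) * (\<alpha> * \<bar>\<sigma> * x\<bar> powr (\<alpha> - 1)))"
    using DERIV_abs_powr[of "\<sigma> * x" \<alpha>, THEN DERIV_cmult[of _ _ _ _ a],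
        THEN DERIV_add[OF _ DERIV_const[of c]]] x assms(3)
    by (intro DERIV_imp_deriv) auto
  then have "\<bar>deriv (\<lambda>u. a * \<bar>u\<bar> powr \<alpha> + c) (\<sigma> * x)\<bar> = \<bar>a\<bar> * \<alpha> * x powr (\<alpha> - 1)"
    using x assms by (auto simp: abs_mult abs_sgn_eq)
  moreover have "0 < \<bar>a\<bar> * \<alpha>" using \<open>a \<noteq> 0\<close> \<open>0 < \<alpha>\<close> by simp
  ultimately show False
    using assms(4)[OF x] by linarith
qed

context geometric_lorenz_flow
begin

text \<open>Since \<open>\<bar>x\<bar> powr \<alpha>\<close> tends to 0, the one-sided limits at 0
  are the constant terms of the branches.\<close>

lemma b0_eq: "b0 = - 1/2" and b1_eq: "b1 = 1/2"
proof -
  have lim: "((\<lambda>x. \<bar>x\<bar> powr \<alpha>) \<longlongrightarrow> 0) (at 0 within A)" for A :: "real set"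
    using alpha_bounds by (intro tendsto_zero_powrI[where b = \<alpha>] tendsto_rabs_zero tendsto_ident_at tendsto_const) auto
  have "((\<lambda>x. \<theta> * \<bar>x\<bar> powr \<alpha> + b0) \<longlongrightarrow> \<theta> * 0 + b0) (at_right 0)"
    by (intro tendsto_intros lim)
  moreover have "((\<lambda>x. \<theta> * \<bar>x\<bar> powr \<alpha> + b0) \<longlongrightarrow> - 1/2) (at_right 0)"
    using f_right by (rule Lim_transform_eventually)
      (auto simp: eventually_at_filter lorenz_f_def)
  ultimately show "b0 = - 1/2"
    using tendsto_unique trivial_limit_at_right_real by fastforce
  have "((\<lambda>x. - \<theta> * \<bar>x\<bar> powr \<alpha> + b1) \<longlongrightarrow> - \<theta> * 0 + b1) (at_left 0)"
    by (intro tendsto_intros lim)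
  moreover have "((\<lambda>x. - \<theta> * \<bar>x\<bar> powr \<alpha> + b1) \<longlongrightarrow> 1/2) (at_left 0)"
    using f_left by (rule Lim_transform_eventually)
      (auto simp: eventually_at_filter lorenz_f_def)
  ultimately show "b1 = 1/2"
    using tendsto_unique trivial_limit_at_left_real by fastforce
qed

section \<open>The right branch of the one-dimensional map and its inverse\<close>

lemma lorenz_f_odd_form:
  "x \<noteq> 0 \<Longrightarrow> lorenz_f \<alpha> \<theta> b0 b1 x = sgn x * (\<theta> * \<bar>x\<bar> powr \<alpha> - 1/2)"
  by (simp add: lorenz_f_def b0_eq b1_eq sgn_if)

lemma right_branch_deriv_gt:
  assumes "0 < u" "u \<le> 1/2"
  shows "sqrt 2 < \<theta> * (\<alpha> * u powr (\<alpha> - 1))"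
proof -
  have "(lorenz_f \<alpha> \<theta> b0 b1 has_real_derivative \<theta> * (\<alpha> * u powr (\<alpha> - 1))) (at u)"
  proof (rule has_field_derivative_transform_within_open[of "\<lambda>x. \<theta> * \<bar>x\<bar> powr \<alpha> + b0" _ _ "{0<..}"])
    show "((\<lambda>x. \<theta> * \<bar>x\<bar> powr \<alpha> + b0) has_real_derivative \<theta> * (\<alpha> * u powr (\<alpha> - 1))) (at u)"
      using assms DERIV_abs_powr[of u \<alpha>, THEN DERIV_cmult, THEN DERIV_add, OF _ DERIV_const]
      by simp
  qed (use assms in \<open>auto simp: lorenz_f_def\<close>)
  then show ?thesis
    using f_expanding[of u] assms by (simp add: DERIV_imp_deriv lorenz_I_iff)
qed

lemma theta_pos: "0 < \<theta>"
proof -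
  have "0 < \<theta> * (\<alpha> * (1/2) powr (\<alpha> - 1))"
    using right_branch_deriv_gt[of "1/2"] real_sqrt_ge_zero[of 2] by linarith
  moreover have "0 < \<alpha> * (1/2) powr (\<alpha> - 1)" using alpha_bounds by simp
  ultimately show ?thesis by (rule zero_less_mult_pos2)
qed

text \<open>The value at 1/2, hence the top of the range of the right branch.\<close>

definition f_top :: real where
  "f_top = \<theta> * (1/2) powr \<alpha> - 1/2"

lemma f_top_less: "f_top < 1/2"
proof -
  have "\<bar>f_top\<bar> \<le> 1/2" "f_top \<noteq> 1/2"
    using f_range[of "1/2"] f_ends(2) by (simp_all add: f_top_def lorenz_I_iff lorenz_f_odd_form)
  then show ?thesis by linarith
qed

text \<open>The slope at 1/2 is \<open>\<alpha> * (2 * f_top + 1)\<close>; it exceeds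
  \<open>sqrt 2\<close> while \<open>\<alpha> < 1\<close>.\<close>

lemma f_top_gt: "sqrt 2 < 2 * f_top + 1"
proof -
  have "\<theta> * (\<alpha> * (1/2) powr (\<alpha> - 1)) = \<alpha> * (2 * f_top + 1)"
    by (simp add: f_top_def powr_diff)
  then have "sqrt 2 < \<alpha> * (2 * f_top + 1)"
    using right_branch_deriv_gt[of "1/2"] by linarith
  also have "\<dots> \<le> 1 * (2 * f_top + 1)"
  proof (rule mult_right_mono)
    show "0 \<le> 2 * f_top + 1" using theta_pos by (simp add: f_top_def)
  qed (use alpha_bounds in auto)
  finally show ?thesis by simp
qed

lemma f_top_pos: "0 < f_top"
proof -
  have "1 < sqrt (2::real)" by simp
  then show ?thesis using f_top_gt by linarith
qed

text \<open>The inverse of the right branch of \<open>f\<close>; by oddness it also describes the left branch.\<close>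

definition binv :: "real \<Rightarrow> real" where
  "binv v = ((v + 1/2) / \<theta>) powr (1 / \<alpha>)"

lemma binv_pos: "- 1/2 < v \<Longrightarrow> 0 < binv v"
  using theta_pos by (simp add: binv_def)

lemma branch_binv: "- 1/2 < v \<Longrightarrow> \<theta> * binv v powr \<alpha> - 1/2 = v"
  using theta_pos alpha_bounds by (simp add: binv_def powr_powr)

lemma binv_branch: "0 < u \<Longrightarrow> binv (\<theta> * u powr \<alpha> - 1/2) = u"
  using theta_pos alpha_bounds by (simp add: binv_def powr_powr)

lemma binv_f_top: "binv f_top = 1/2"
  using binv_branch[of "1/2"] by (simp add: f_top_def)

lemma binv_strict_mono: "- 1/2 < v \<Longrightarrow> v < w \<Longrightarrow> binv v < binv w"
  using theta_pos alpha_bounds unfolding binv_def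
  by (intro powr_less_mono2) (auto simp: divide_strict_right_mono)

lemma binv_mono: "- 1/2 < v \<Longrightarrow> v \<le> w \<Longrightarrow> binv v \<le> binv w"
  using binv_strict_mono[of v w] by (cases "v = w") auto

text \<open>Mean value theorem for the right branch: \<open>binv\<close> takes values up to
  \<open>f_top\<close> into the range \<open>(0, 1/2]\<close>, where the slope exceeds
  \<open>sqrt 2\<close>.\<close>

lemma binv_contraction:
  assumes "- 1/2 < v" "v \<le> f_top" "- 1/2 < w" "w \<le> f_top"
  shows "\<bar>binv v - binv w\<bar> \<le> \<bar>v - w\<bar> / sqrt 2"
proof -
  have *: "sqrt 2 * (binv w - binv v) \<le> w - v" if "- 1/2 < v" "v < w" "w \<le> f_top" for v w
  proof -
    let ?F = "\<lambda>u. \<theta> * \<bar>u\<bar> powr \<alpha> - 1/2"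
    have pos: "0 < binv v" "binv v < binv w" "binv w \<le> 1/2"
      using that binv_pos binv_strict_mono binv_mono[of w f_top] binv_f_top by auto
    have "\<exists>z. binv v < z \<and> z < binv w
        \<and> ?F (binv w) - ?F (binv v) = (binv w - binv v) * (\<theta> * (\<alpha> * z powr (\<alpha> - 1)))"
    proof (rule MVT2)
      fix u assume "binv v \<le> u" "u \<le> binv w"
      then show "(?F has_real_derivative \<theta> * (\<alpha> * u powr (\<alpha> - 1))) (at u)"
        using pos DERIV_abs_powr[of u \<alpha>, THEN DERIV_cmult, THEN DERIV_diff, OF _ DERIV_const]
        by simp
    qed (use pos in auto)
    then obtain z where z: "binv v < z" "z < binv w"
        and eq: "?F (binv w) - ?F (binv v) = (binv w - binv v) * (\<theta> * (\<alpha> * z powr (\<alpha> - 1)))"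
      by blast
    have "?F (binv w) = w" "?F (binv v) = v"
      using that pos branch_binv by auto
    then have "w - v = (binv w - binv v) * (\<theta> * (\<alpha> * z powr (\<alpha> - 1)))"
      using eq by simp
    moreover have "(binv w - binv v) * sqrt 2 \<le> (binv w - binv v) * (\<theta> * (\<alpha> * z powr (\<alpha> - 1)))"
      using pos z right_branch_deriv_gt[of z] by (intro mult_left_mono) auto
    ultimately show ?thesis by (simp add: mult.commute)
  qed
  consider "v < w" | "v = w" | "w < v" by linarith
  then show ?thesis
  proof cases
    case 1
    with *[of v w] binv_strict_mono[of v w] assms show ?thesis by (simp add: field_simps)
  next
    case 3
    with *[of w v] binv_strict_mono[of w v] assms show ?thesis by (simp add: field_simps)
  qed simp
qed

text \<open>On each side of 0 the affine map contributes a multiple of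
  \<open>\<bar>x\<bar> powr \<alpha>\<close>, which the bound on the \<open>x\<close>-derivative
  excludes; the size of the \<open>y\<close>-derivative makes the coefficient of the remaining term
  a sign.\<close>

lemma lorenz_g_form:
  obtains \<epsilon> c :: "real \<Rightarrow> real" where
    "\<And>s. \<bar>\<epsilon> s\<bar> = 1"
    "\<And>x y. x \<noteq> 0 \<Longrightarrow> lorenz_g \<alpha> \<beta> g0 g1 x y = c (sgn x) + \<epsilon> (sgn x) * (y * \<bar>x\<bar> powr \<beta>)"
proof -
  have one: "\<exists>e c. \<bar>e\<bar> = 1 \<and> (\<forall>x y. sgn x = \<sigma> \<longrightarrow> lorenz_g \<alpha> \<beta> g0 g1 x y = c + e * (y * \<bar>x\<bar> powr \<beta>))"
    if h: "affine_function h" and \<sigma>: "\<bar>\<sigma>\<bar> = 1"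
      and gh: "\<And>x y. sgn x = \<sigma> \<Longrightarrow> lorenz_g \<alpha> \<beta> g0 g1 x y = h (\<bar>x\<bar> powr \<alpha>, y * \<bar>x\<bar> powr \<beta>)"
    for h and \<sigma> :: real
  proof -
    obtain a b c where abc: "\<And>u v. h (u, v) = a * u + b * v + c"
      using affine_function_prodE[OF h] by blast
    obtain M where M: "\<And>x y. x \<in> lorenz_I - {0} \<Longrightarrow> y \<in> lorenz_I \<Longrightarrow>
        \<bar>deriv (\<lambda>u. lorenz_g \<alpha> \<beta> g0 g1 u y) x\<bar> \<le> M"
      using g_dx by blast
    have "a = 0"
    proof (rule affine_abs_powr_deriv_bounded[OF alpha_bounds \<sigma>])
      fix x :: real assume x: "0 < x" "x \<le> 1/2"
      have sx: "sgn (\<sigma> * x) = \<sigma>" using \<sigma> x by (auto simp: sgn_if abs_if split: if_splits)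
      \<comment> \<open>On this half-line, taking \<open>y = 0\<close> leaves only the term in
        \<open>\<bar>u\<bar> powr \<alpha>\<close> and the constant.\<close>
      have "eventually (\<lambda>u. u \<in> {u. 0 < \<sigma> * u}) (nhds (\<sigma> * x))"
        using x \<sigma> by (intro eventually_nhds_in_open open_Collect_less continuous_intros)
          (auto simp: abs_if split: if_splits)
      then have "eventually (\<lambda>u. lorenz_g \<alpha> \<beta> g0 g1 u 0 = a * \<bar>u\<bar> powr \<alpha> + c) (nhds (\<sigma> * x))"
      proof eventually_elim
        case (elim u)
        then have "sgn u = \<sigma>" using \<sigma> by (auto simp: sgn_if abs_if zero_less_mult_iff split: if_splits)
        then show ?case by (simp add: gh abc)
      qed
      then have "deriv (\<lambda>u. lorenz_g \<alpha> \<beta> g0 g1 u 0) (\<sigma> * x) = deriv (\<lambda>u. a * \<bar>u\<bar> powr \<alpha> + c) (\<sigma> * x)"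
        by (intro deriv_cong_ev) auto
      moreover have "\<sigma> * x \<in> lorenz_I - {0}" using x \<sigma> by (auto simp: lorenz_I_iff abs_mult)
      ultimately show "\<bar>deriv (\<lambda>u. a * \<bar>u\<bar> powr \<alpha> + c) (\<sigma> * x)\<bar> \<le> M"
        using M[of "\<sigma> * x" 0] by (simp add: lorenz_I_iff)
    qed
    have form: "lorenz_g \<alpha> \<beta> g0 g1 x y = c + b * (y * \<bar>x\<bar> powr \<beta>)" if "sgn x = \<sigma>" for x y
      using gh[OF that] by (simp add: abc \<open>a = 0\<close>)
    \<comment> \<open>The coefficient \<open>b\<close> is read off at the sample point
      \<open>\<sigma> / 2\<close>.\<close>
    have s2: "sgn (\<sigma> / 2) = \<sigma>" using \<sigma> by (auto simp: sgn_if abs_if split: if_splits)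
    have "deriv (\<lambda>v. lorenz_g \<alpha> \<beta> g0 g1 (\<sigma> / 2) v) 0 = b * \<bar>\<sigma> / 2\<bar> powr \<beta>"
      by (intro DERIV_imp_deriv) (auto simp: form[OF s2] intro!: derivative_eq_intros)
    moreover have "\<sigma> / 2 \<in> lorenz_I - {0}" using \<sigma> by (auto simp: lorenz_I_iff)
    moreover have "0 \<in> lorenz_I" by (simp add: lorenz_I_iff)
    ultimately have "\<bar>b * \<bar>\<sigma> / 2\<bar> powr \<beta>\<bar> = \<bar>\<sigma> / 2\<bar> powr \<beta>"
      using g_dy by metis
    then have "\<bar>b\<bar> = 1" using \<sigma> by (simp add: abs_mult)
    then show ?thesis using form by blast
  qed
  obtain e0 c0 where 0: "\<bar>e0\<bar> = 1" "\<And>x y. sgn x = 1 \<Longrightarrow> lorenz_g \<alpha> \<beta> g0 g1 x y = c0 + e0 * (y * \<bar>x\<bar> powr \<beta>)"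
    using one[of g0 1, OF g_affine(1)] by (auto simp: lorenz_g_def sgn_1_pos)
  obtain e1 c1 where 1: "\<bar>e1\<bar> = 1" "\<And>x y. sgn x = -1 \<Longrightarrow> lorenz_g \<alpha> \<beta> g0 g1 x y = c1 + e1 * (y * \<bar>x\<bar> powr \<beta>)"
    using one[of g1 "-1", OF g_affine(2)] by (auto simp: lorenz_g_def sgn_1_neg)
  show ?thesis
  proof (rule that[of "\<lambda>s. if s = 1 then e0 else e1" "\<lambda>s. if s = 1 then c0 else c1"])
    fix x y :: real assume "x \<noteq> 0"
    then have "sgn x = 1 \<or> sgn x = -1" by (auto simp: sgn_if)
    then show "lorenz_g \<alpha> \<beta> g0 g1 x y = (if sgn x = 1 then c0 else c1)
        + (if sgn x = 1 then e0 else e1) * (y * \<bar>x\<bar> powr \<beta>)"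
      using 0(2) 1(2) by auto
  qed (use 0 1 in auto)
qed

section \<open>Backward orbits in a horseshoe\<close>

text \<open>Gives the vertical contraction rate 1/2, since \<open>\<beta> > 1\<close>.\<close>

lemma lorenz_I_powr_beta_le: "x \<in> lorenz_I \<Longrightarrow> \<bar>x\<bar> powr \<beta> \<le> 1/2"
  using powr_mono'[of 1 \<beta> "\<bar>x\<bar>"] beta_gt_1 by (simp add: lorenz_I_iff)

lemma abs_powr_beta_lipschitz:
  assumes "0 < u" "u \<le> 1" "0 < v" "v \<le> 1"
  shows "\<bar>u powr \<beta> - v powr \<beta>\<bar> \<le> \<beta> * \<bar>u - v\<bar>"
proof -
  have "norm (u powr \<beta> - v powr \<beta>) \<le> \<beta> * norm (u - v)"
  proof (rule field_differentiable_bound)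
    fix z :: real assume z: "z \<in> {0<..1}"
    then have "0 < z" "z \<le> 1" by simp_all
    then show "((\<lambda>z. z powr \<beta>) has_real_derivative \<beta> * z powr (\<beta> - 1)) (at z within {0<..1})"
      using has_real_derivative_powr[THEN has_field_derivative_at_within] by blast
    have "z powr (\<beta> - 1) \<le> 1"
      using \<open>0 < z\<close> \<open>z \<le> 1\<close> beta_gt_1 by (intro powr_le1) linarith+
    then show "norm (\<beta> * z powr (\<beta> - 1)) \<le> \<beta>"
      using beta_gt_1 by (simp add: abs_mult mult_left_le)
  qed (use assms in simp_all)
  then show ?thesis by simp
qed

text \<open>
  The two preimages of \<open>x\<close> under \<open>f\<close>: \<open>preA x\<close> lies on the opposite side of \<open>0\<close>, \<open>preB x\<close> on the
  same side.
\<close>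

definition preA :: "real \<Rightarrow> real" where
  "preA x = - sgn x * binv (- \<bar>x\<bar>)"

definition preB :: "real \<Rightarrow> real" where
  "preB x = sgn x * binv \<bar>x\<bar>"

lemma preA_abs_sgn:
  assumes "x \<noteq> 0" "\<bar>x\<bar> < 1/2"
  shows "\<bar>preA x\<bar> = binv (- \<bar>x\<bar>)" "sgn (preA x) = - sgn x" "lorenz_f \<alpha> \<theta> b0 b1 (preA x) = x"
proof -
  have pos: "0 < binv (- \<bar>x\<bar>)" using assms by (intro binv_pos) auto
  then show 1: "\<bar>preA x\<bar> = binv (- \<bar>x\<bar>)" "sgn (preA x) = - sgn x"
    using assms(1) by (auto simp: preA_def abs_mult sgn_mult abs_sgn_eq)
  have "preA x \<noteq> 0" using 1(1) pos by auto
  then show "lorenz_f \<alpha> \<theta> b0 b1 (preA x) = x"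
    using branch_binv[of "- \<bar>x\<bar>"] assms by (simp add: lorenz_f_odd_form 1 sgn_mult_abs)
qed

lemma preB_abs_sgn:
  assumes "x \<noteq> 0"
  shows "\<bar>preB x\<bar> = binv \<bar>x\<bar>" "sgn (preB x) = sgn x" "lorenz_f \<alpha> \<theta> b0 b1 (preB x) = x"
proof -
  have pos: "0 < binv \<bar>x\<bar>" by (intro binv_pos) auto
  then show 1: "\<bar>preB x\<bar> = binv \<bar>x\<bar>" "sgn (preB x) = sgn x"
    using assms(1) by (auto simp: preB_def abs_mult sgn_mult abs_sgn_eq)
  have "preB x \<noteq> 0" using 1(1) pos by auto
  then show "lorenz_f \<alpha> \<theta> b0 b1 (preB x) = x"
    using branch_binv[of "\<bar>x\<bar>"] assms by (simp add: lorenz_f_odd_form 1 sgn_mult_abs)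
qed

text \<open>A zero \<open>p\<close> of \<open>?h\<close> is a point which the right branch sends to
  \<open>- p\<close>. The intermediate value theorem yields one below \<open>f_top\<close>, because
  the slope bound \<open>sqrt 2\<close> makes \<open>?h f_top\<close> positive.\<close>

lemma horseshoe_parameters_exist:
  obtains p \<eta> :: real and N :: nat where "binv (- p) = p" "0 < \<eta>" "\<eta> < p" "p + \<eta> < f_top"
    "1/2 \<le> \<eta> * sqrt 2 ^ N"
proof -
  let ?h = "\<lambda>u. \<theta> * u powr \<alpha> - 1/2 + u"
  have k: "\<theta> = (f_top + 1/2) * 2 powr \<alpha>"
    by (simp add: f_top_def flip: powr_mult)
  \<comment> \<open>As \<open>2 * f_top < 1\<close>, lowering the exponent from 1 to
    \<open>\<alpha>\<close> enlarges the power; this reduces the claim \<open>0 < ?h f_top\<close>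
    to a quadratic inequality.\<close>
  have "2 * f_top \<le> (2 * f_top) powr \<alpha>"
    using f_top_pos f_top_less alpha_bounds powr_mono'[of \<alpha> 1 "2 * f_top"] by simp
  then have "(f_top + 1/2) * (2 * f_top) \<le> (f_top + 1/2) * (2 * f_top) powr \<alpha>"
    using f_top_pos by (intro mult_left_mono) auto
  also have "\<dots> = \<theta> * f_top powr \<alpha>"
    using powr_mult[of 2 f_top \<alpha>] k by simp
  finally have h1: "(f_top + 1/2) * (2 * f_top) - 1/2 + f_top \<le> ?h f_top" by simp
  \<comment> \<open>The quadratic inequality in question, after completing the square.\<close>
  have "2 < (2 * f_top + 1)\<^sup>2"
    using f_top_gt power_strict_mono[of "sqrt 2" "2 * f_top + 1" 2] by simp
  then have "0 < (f_top + 1/2) * (2 * f_top) - 1/2 + f_top"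
    by (simp add: power2_eq_square field_simps)
  then have h2: "0 < ?h f_top" using h1 by linarith
  have "continuous_on {0..f_top} ?h"
    using alpha_bounds by (intro continuous_intros continuous_on_powr') auto
  moreover have "?h 0 \<le> 0" by simp
  ultimately obtain p where p: "0 \<le> p" "p \<le> f_top" "?h p = 0"
    using IVT'[of ?h 0 0 f_top] h2 f_top_pos by auto
  have "p \<noteq> 0" "p \<noteq> f_top" using p(3) h2 by auto
  then have p': "0 < p" "p < f_top" using p by auto
  \<comment> \<open>Half the margin, so that the interval around \<open>p\<close> stays away from 0
    and below \<open>f_top\<close>.\<close>
  define \<eta> where "\<eta> = min p (f_top - p) / 2"
  have \<eta>: "0 < \<eta>" "\<eta> < p" "p + \<eta> < f_top" using p' by (auto simp: \<eta>_def min_def field_simps)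
  obtain N where "1 / (2 * \<eta>) < sqrt 2 ^ N"
    using real_arch_pow[of "sqrt 2"] by auto
  then have "1/2 \<le> \<eta> * sqrt 2 ^ N" using \<eta> by (simp add: field_simps)
  moreover have "binv (- p) = p"
  proof -
    have "\<theta> * p powr \<alpha> - 1/2 = - p" using p(3) by linarith
    then show ?thesis using binv_branch[of p] p'(1) by simp
  qed
  ultimately show ?thesis using that \<eta> by blast
qed

end

text \<open>
  Since \<open>p\<close> is fixed by \<open>u \<mapsto> binv (- u)\<close>, the points \<open>p\<close> and \<open>- p\<close> form an orbit of period two.
  The number \<open>N\<close> is the number of steps with \<open>preA\<close> after which every point reached by \<open>preB\<close>
  is back within distance \<open>\<eta>\<close> of this orbit.
\<close>

locale lorenz_horseshoe = geometric_lorenz_flow +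
  fixes \<epsilon> c :: "real \<Rightarrow> real" and p \<eta> :: real and N :: nat
  assumes eps: "\<And>s. \<bar>\<epsilon> s\<bar> = 1"
    and g_form: "\<And>x y. x \<noteq> 0 \<Longrightarrow> lorenz_g \<alpha> \<beta> g0 g1 x y = c (sgn x) + \<epsilon> (sgn x) * (y * \<bar>x\<bar> powr \<beta>)"
    and p_fixed: "binv (- p) = p"
    and eta: "0 < \<eta>" "\<eta> < p" "p + \<eta> < f_top"
    and N_large: "1/2 \<le> \<eta> * sqrt 2 ^ N"
begin

section \<open>Points from which pulling back can go on for ever\<close>

abbreviation f :: "real \<Rightarrow> real" where "f \<equiv> lorenz_f \<alpha> \<theta> b0 b1"
abbreviation g :: "real \<Rightarrow> real \<Rightarrow> real" where "g \<equiv> lorenz_g \<alpha> \<beta> g0 g1"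

text \<open>Moduli along the coded backward orbits never exceed \<open>umax\<close>: starting points
  have modulus at most \<open>p + \<eta>\<close>, preimages at most
  \<open>binv (p + \<eta>)\<close>. Monotonicity of \<open>binv\<close> then makes
  \<open>umin\<close> a lower bound for the moduli of all preimages.\<close>

definition umax :: real where "umax = max (binv (p + \<eta>)) (p + \<eta>)"
definition umin :: real where "umin = binv (- umax)"

lemma umax_bounds: "0 < umax" "umax < 1/2" "p + \<eta> \<le> umax" "binv (p + \<eta>) \<le> umax"
  using eta f_top_less binv_strict_mono[of "p + \<eta>" f_top] by (auto simp: umax_def max_def binv_f_top)

lemma umin_pos: "0 < umin"
  using umax_bounds by (auto simp: umin_def intro: binv_pos)

text \<open>The deviation allowed is what \<open>n\<close> contractions by \<open>1 / sqrt 2\<close>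
  bring down to \<open>\<eta>\<close>; \<open>valid 0\<close> is the window in which both preimages
  may be chosen.\<close>

definition valid :: "nat \<Rightarrow> real \<Rightarrow> bool" where
  "valid n x \<longleftrightarrow> x \<noteq> 0 \<and> \<bar>\<bar>x\<bar> - p\<bar> \<le> \<eta> * sqrt 2 ^ n \<and> \<bar>x\<bar> \<le> umax"

lemma valid_0: "valid 0 x \<longleftrightarrow> \<bar>\<bar>x\<bar> - p\<bar> \<le> \<eta>"
  using umax_bounds eta by (auto simp: valid_def)

text \<open>On moduli \<open>preA\<close> acts as \<open>u \<mapsto> binv (- u)\<close>, which fixes
  \<open>p\<close> and contracts by \<open>1 / sqrt 2\<close>.\<close>

lemma preA_valid:
  assumes "valid n x"
  shows "valid (n - 1) (preA x)" "umin \<le> \<bar>preA x\<bar>" "sgn (preA x) = - sgn x" "f (preA x) = x"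
proof -
  have x: "x \<noteq> 0" "\<bar>x\<bar> < 1/2" "\<bar>x\<bar> \<le> umax" and xp: "\<bar>\<bar>x\<bar> - p\<bar> \<le> \<eta> * sqrt 2 ^ n"
    using assms umax_bounds by (auto simp: valid_def)
  note pre = preA_abs_sgn[OF x(1,2)]
  show "sgn (preA x) = - sgn x" "f (preA x) = x" by (fact pre)+
  show min: "umin \<le> \<bar>preA x\<bar>"
    unfolding pre umin_def using x umax_bounds by (intro binv_mono) auto
  have "binv (- \<bar>x\<bar>) \<le> binv (p + \<eta>)"
    using x eta by (intro binv_mono) auto
  then have max: "\<bar>preA x\<bar> \<le> umax" using umax_bounds by (simp add: pre)
  have "\<bar>binv (- \<bar>x\<bar>) - binv (- p)\<bar> \<le> \<bar>- \<bar>x\<bar> - (- p)\<bar> / sqrt 2"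
    using x eta f_top_less f_top_pos by (intro binv_contraction) auto
  then have "\<bar>\<bar>preA x\<bar> - p\<bar> \<le> \<bar>\<bar>x\<bar> - p\<bar> / sqrt 2"
    by (simp add: pre p_fixed abs_minus_commute)
  also have "\<dots> \<le> \<eta> * sqrt 2 ^ n / sqrt 2"
    using xp by (intro divide_right_mono) auto
  \<comment> \<open>For \<open>n = 0\<close> the truncated \<open>n - 1\<close> is again 0: the
    window is invariant under \<open>preA\<close>.\<close>
  also have "\<dots> \<le> \<eta> * sqrt 2 ^ (n - 1)"
    using eta by (cases n) (auto simp: field_simps)
  finally show "valid (n - 1) (preA x)"
    using min max umin_pos by (auto simp: valid_def)
qed

text \<open>A \<open>preB\<close> step may land far from \<open>p\<close>, but \<open>N\<close> is
  so large that any deviation up to 1/2 is allowed.\<close>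

lemma preB_valid:
  assumes "valid 0 x"
  shows "valid N (preB x)" "umin \<le> \<bar>preB x\<bar>" "sgn (preB x) = sgn x" "f (preB x) = x"
proof -
  have x: "x \<noteq> 0" "\<bar>x\<bar> \<le> p + \<eta>"
    using assms eta by (auto simp: valid_def)
  note pre = preB_abs_sgn[OF x(1)]
  show "sgn (preB x) = sgn x" "f (preB x) = x" by (fact pre)+
  show min: "umin \<le> \<bar>preB x\<bar>"
    unfolding pre umin_def using x umax_bounds by (intro binv_mono) auto
  have "binv \<bar>x\<bar> \<le> binv (p + \<eta>)"
    using x eta by (intro binv_mono) auto
  then have max: "\<bar>preB x\<bar> \<le> umax" using umax_bounds by (simp add: pre)
  then have "\<bar>\<bar>preB x\<bar> - p\<bar> \<le> 1/2"
    using umax_bounds eta f_top_less by linarith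
  then show "valid N (preB x)"
    using min max umin_pos N_large by (auto simp: valid_def)
qed

lemma preA_lipschitz:
  assumes "valid n x" "valid n x'" "sgn x = sgn x'"
  shows "\<bar>preA x - preA x'\<bar> \<le> \<bar>x - x'\<bar>"
proof -
  have x: "\<bar>x\<bar> < 1/2" "\<bar>x'\<bar> < 1/2" "x \<noteq> 0"
    using assms umax_bounds by (auto simp: valid_def)
  have "\<bar>preA x - preA x'\<bar> = \<bar>binv (- \<bar>x\<bar>) - binv (- \<bar>x'\<bar>)\<bar>"
    using x by (simp add: preA_def assms(3)[symmetric] abs_mult abs_sgn_eq abs_minus_commute 
      flip: right_diff_distrib)
  also have "\<dots> \<le> \<bar>- \<bar>x\<bar> - (- \<bar>x'\<bar>)\<bar> / sqrt 2"
    using x f_top_pos by (intro binv_contraction) auto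
  also have "\<dots> \<le> \<bar>- \<bar>x\<bar> - (- \<bar>x'\<bar>)\<bar> / 1"
    by (intro divide_left_mono) auto
  also have "\<dots> \<le> \<bar>x - x'\<bar>" by simp
  finally show ?thesis .
qed

lemma preB_lipschitz:
  assumes "valid 0 x" "valid 0 x'" "sgn x = sgn x'"
  shows "\<bar>preB x - preB x'\<bar> \<le> \<bar>x - x'\<bar>"
proof -
  have x: "\<bar>x\<bar> \<le> f_top" "\<bar>x'\<bar> \<le> f_top" "x \<noteq> 0"
    using assms eta by (auto simp: valid_def)
  have "\<bar>preB x - preB x'\<bar> = \<bar>binv \<bar>x\<bar> - binv \<bar>x'\<bar>\<bar>"
    using x by (simp add: preB_def assms(3)[symmetric] abs_mult abs_sgn_eq
      flip: right_diff_distrib)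
  also have "\<dots> \<le> \<bar>\<bar>x\<bar> - \<bar>x'\<bar>\<bar> / sqrt 2"
    using x by (intro binv_contraction) auto
  also have "\<dots> \<le> \<bar>\<bar>x\<bar> - \<bar>x'\<bar>\<bar> / 1"
    by (intro divide_left_mono) auto
  also have "\<dots> \<le> \<bar>x - x'\<bar>" by simp
  finally show ?thesis .
qed

text \<open>
  A state \<open>(x, n, r)\<close> selects a backward orbit of \<open>x\<close>: the next \<open>n\<close> preimages are taken with \<open>preA\<close>,
  afterwards the binary digits of \<open>r\<close> decide between \<open>preA\<close> and one \<open>preB\<close> followed by \<open>N\<close>
  steps with \<open>preA\<close>.
\<close>

fun pred_state :: "real \<times> nat \<times> real \<Rightarrow> real \<times> nat \<times> real" where
  "pred_state (x, Suc n, r) = (preA x, n, r)"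
| "pred_state (x, 0, r) = (if r < 1/2 then (preA x, 0, 2 * r) else (preB x, N, 2 * r - 1))"

fun admissible :: "real \<times> nat \<times> real \<Rightarrow> bool" where
  "admissible (x, n, r) \<longleftrightarrow> valid n x \<and> 0 \<le> r \<and> r < 1"

lemma pred_state_admissible:
  assumes "admissible \<sigma>"
  shows "admissible (pred_state \<sigma>)" "umin \<le> \<bar>fst (pred_state \<sigma>)\<bar>" "f (fst (pred_state \<sigma>)) = fst \<sigma>"
  using assms preA_valid preB_valid by (cases \<sigma> rule: pred_state.cases; force)+

lemma admissible_fst: "admissible \<sigma> \<Longrightarrow> fst \<sigma> \<in> lorenz_I - {0}"
  using umax_bounds by (cases \<sigma>) (auto simp: valid_def lorenz_I_iff)

section \<open>Heights of coded backward orbits\<close>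

lemma g_diff_le:
  assumes "x \<in> lorenz_I - {0}"
  shows "\<bar>g x y - g x y'\<bar> \<le> \<bar>y - y'\<bar> / 2"
proof -
  have "\<bar>g x y - g x y'\<bar> = \<bar>y - y'\<bar> * \<bar>x\<bar> powr \<beta>"
    using assms by (simp add: g_form abs_mult eps flip: right_diff_distrib left_diff_distrib)
  also have "\<dots> \<le> \<bar>y - y'\<bar> * (1/2)"
    using assms by (intro mult_left_mono lorenz_I_powr_beta_le) auto
  finally show ?thesis by simp
qed

text \<open>Goes back \<open>m\<close> steps along the coded orbit, takes height 0 there and pushes
  it forward by \<open>g\<close>.\<close>

primrec height_approx :: "nat \<Rightarrow> real \<times> nat \<times> real \<Rightarrow> real" where
  "height_approx 0 \<sigma> = 0"
| "height_approx (Suc m) \<sigma> = g (fst (pred_state \<sigma>)) (height_approx m (pred_state \<sigma>))"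

text \<open>The second coordinate of the point over \<open>fst \<sigma>\<close> whose backward orbit
  under the Poincare map follows the code.\<close>

definition height :: "real \<times> nat \<times> real \<Rightarrow> real" where
  "height \<sigma> = lim (\<lambda>m. height_approx m \<sigma>)"

lemma height_approx_mem: "admissible \<sigma> \<Longrightarrow> height_approx m \<sigma> \<in> lorenz_I"
proof (induction m arbitrary: \<sigma>)
  case (Suc m)
  then show ?case using g_range admissible_fst pred_state_admissible by simp
qed (simp add: lorenz_I_iff)

lemma height_approx_step:
  "admissible \<sigma> \<Longrightarrow> \<bar>height_approx (Suc m) \<sigma> - height_approx m \<sigma>\<bar> \<le> (1/2) ^ m"
proof (induction m arbitrary: \<sigma>)
  case 0
  then show ?case using height_approx_mem[of \<sigma> 1] by (simp add: lorenz_I_iff)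
next
  case (Suc m)
  let ?s = "pred_state \<sigma>"
  have "\<bar>height_approx (Suc (Suc m)) \<sigma> - height_approx (Suc m) \<sigma>\<bar>
      \<le> \<bar>height_approx (Suc m) ?s - height_approx m ?s\<bar> / 2"
    using g_diff_le[OF admissible_fst[OF pred_state_admissible(1)[OF Suc.prems]]] by simp
  also have "\<dots> \<le> (1/2) ^ Suc m"
    using Suc.IH[OF pred_state_admissible(1)[OF Suc.prems]] by simp
  finally show ?case .
qed

lemma height_approx_tendsto:
  assumes "admissible \<sigma>"
  shows "(\<lambda>m. height_approx m \<sigma>) \<longlonglongrightarrow> height \<sigma>"
proof -
  have "summable (\<lambda>m. height_approx (Suc m) \<sigma> - height_approx m \<sigma>)"
    using height_approx_step[OF assms]
    by (intro summable_comparison_test'[OF summable_geometric[of "1/2"], of 0]) auto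
  then have "convergent (\<lambda>n. \<Sum>m<n. height_approx (Suc m) \<sigma> - height_approx m \<sigma>)"
    by (simp add: summable_iff_convergent)
  then have "convergent (\<lambda>m. height_approx m \<sigma>)"
    unfolding sum_lessThan_telescope[of "\<lambda>m. height_approx m \<sigma>"] by simp
  then show ?thesis unfolding height_def by (simp add: convergent_LIMSEQ_iff)
qed

lemma height_mem: "admissible \<sigma> \<Longrightarrow> height \<sigma> \<in> lorenz_I"
  using height_approx_mem
  by (intro closed_sequentially[OF _ _ height_approx_tendsto]) (auto simp: lorenz_I_def)

lemma height_pred:
  assumes "admissible \<sigma>"
  shows "height \<sigma> = g (fst (pred_state \<sigma>)) (height (pred_state \<sigma>))"
proof -
  have nz: "fst (pred_state \<sigma>) \<noteq> 0"
    using admissible_fst pred_state_admissible(1)[OF assms] by blast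
  have "(\<lambda>m. height_approx (Suc m) \<sigma>) \<longlonglongrightarrow> g (fst (pred_state \<sigma>)) (height (pred_state \<sigma>))"
    using height_approx_tendsto[OF pred_state_admissible(1)[OF assms]]
    by (auto simp: g_form[OF nz] intro!: tendsto_intros)
  then show ?thesis
    using LIMSEQ_unique LIMSEQ_Suc[OF height_approx_tendsto[OF assms]] by blast
qed

text \<open>By \<open>height_pred\<close> the Poincare map sends the point coded by
  \<open>pred_state \<sigma>\<close> to the one coded by \<open>\<sigma>\<close>, so the induction
  moves backward along the orbit.\<close>

lemma poincare_image_mem:
  "admissible \<sigma> \<Longrightarrow> section_point (fst \<sigma>) (height \<sigma>) \<in> poincare_image \<phi> i"
proof (induction i arbitrary: \<sigma>)
  case 0
  then show ?case using admissible_fst height_mem by (simp add: section_point_mem_S_star_iff)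
next
  case (Suc i)
  let ?s = "pred_state \<sigma>"
  have s: "admissible ?s" using Suc.prems by (rule pred_state_admissible)
  have mem: "fst ?s \<in> lorenz_I - {0}" "height ?s \<in> lorenz_I"
    using s admissible_fst height_mem by auto
  have "poincare_map \<phi> lorenz_S (section_point (fst ?s) (height ?s)) = section_point (fst \<sigma>) (height \<sigma>)"
    using poincare_form[OF mem] pred_state_admissible(3)[OF Suc.prems] height_pred[OF Suc.prems] by simp
  moreover have "section_point (fst ?s) (height ?s) \<in> poincare_image \<phi> i \<inter> lorenz_S_star"
    using Suc.IH[OF s] mem by (simp add: section_point_mem_S_star_iff)
  ultimately show ?case by (metis imageI poincare_image.simps(2))
qed

lemma Lambda_P_mem: "admissible \<sigma> \<Longrightarrow> section_point (fst \<sigma>) (height \<sigma>) \<in> Lambda_P \<phi>"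
  unfolding Lambda_P_def using poincare_image_mem by (intro subsetD[OF closure_subset]) blast

lemma g_lipschitz:
  assumes x: "x \<in> lorenz_I - {0}" "x' \<in> lorenz_I - {0}" "sgn x = sgn x'"
    and y: "y \<in> lorenz_I"
  shows "\<bar>g x y - g x' y'\<bar> \<le> \<beta> / 2 * \<bar>x - x'\<bar> + \<bar>y - y'\<bar> / 2"
proof -
  have "\<bar>g x y - g x' y\<bar> = \<bar>y\<bar> * \<bar>\<bar>x\<bar> powr \<beta> - \<bar>x'\<bar> powr \<beta>\<bar>"
    using x by (simp add: g_form abs_mult eps flip: right_diff_distrib)
  also have "\<dots> \<le> 1/2 * (\<beta> * \<bar>\<bar>x\<bar> - \<bar>x'\<bar>\<bar>)"
    using x y by (intro mult_mono abs_powr_beta_lipschitz) (auto simp: lorenz_I_iff)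
  also have "\<dots> \<le> 1/2 * (\<beta> * \<bar>x - x'\<bar>)"
    using beta_gt_1 by (intro mult_left_mono) auto
  finally have "\<bar>g x y - g x' y\<bar> \<le> \<beta> / 2 * \<bar>x - x'\<bar>" by simp
  then show ?thesis using g_diff_le[OF x(2), of y y'] by linarith
qed

text \<open>Equal codes and signs select the same inverse branches, which do not increase horizontal
  distances. The recursion reproduces the constant: \<open>\<beta> / 2\<close> from the change of
  \<open>x\<close>, plus half of \<open>\<beta>\<close> from the previous heights.\<close>

lemma height_lipschitz:
  assumes "admissible (x, n, r)" "admissible (x', n, r)" "sgn x = sgn x'"
  shows "\<bar>height (x, n, r) - height (x', n, r)\<bar> \<le> \<beta> * \<bar>x - x'\<bar>"
proof -
  have "\<bar>height_approx m (x, n, r) - height_approx m (x', n, r)\<bar> \<le> \<beta> * \<bar>x - x'\<bar>" for m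
    using assms
  proof (induction m arbitrary: x x' n r)
    case 0
    then show ?case using beta_gt_1 by simp
  next
    case (Suc m)
    have "\<exists>h k s. pred_state (x, n, r) = (h x, k, s) \<and> pred_state (x', n, r) = (h x', k, s)
        \<and> \<bar>h x - h x'\<bar> \<le> \<bar>x - x'\<bar> \<and> sgn (h x) = sgn (h x')"
    proof (cases n)
      case (Suc l)
      have v: "valid (Suc l) x" "valid (Suc l) x'" using Suc.prems Suc by auto
      show ?thesis
        using preA_lipschitz[OF v Suc.prems(3)] preA_valid(3)[OF v(1)] preA_valid(3)[OF v(2)]
        by (intro exI[of _ preA] exI[of _ l] exI[of _ r]) (simp add: Suc Suc.prems(3))
    next
      case 0
      have v: "valid 0 x" "valid 0 x'" using Suc.prems 0 by auto
      show ?thesis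
      proof (cases "r < 1/2")
        case True
        then show ?thesis
          using preA_lipschitz[OF v Suc.prems(3)] preA_valid(3)[OF v(1)] preA_valid(3)[OF v(2)]
          by (intro exI[of _ preA] exI[of _ 0] exI[of _ "2 * r"]) (simp add: 0 Suc.prems(3))
      next
        case False
        then show ?thesis
          using preB_lipschitz[OF v Suc.prems(3)] preB_valid(3)[OF v(1)] preB_valid(3)[OF v(2)]
          by (intro exI[of _ preB] exI[of _ N] exI[of _ "2 * r - 1"]) (simp add: 0 Suc.prems(3))
      qed
    qed
    then obtain h k s where pre: "pred_state (x, n, r) = (h x, k, s)" "pred_state (x', n, r) = (h x', k, s)"
      and h: "\<bar>h x - h x'\<bar> \<le> \<bar>x - x'\<bar>" "sgn (h x) = sgn (h x')"
      by blast
    have adm: "admissible (h x, k, s)" "admissible (h x', k, s)"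
      using pred_state_admissible(1) Suc.prems(1,2) pre by metis+
    have "\<bar>height_approx (Suc m) (x, n, r) - height_approx (Suc m) (x', n, r)\<bar>
        \<le> \<beta> / 2 * \<bar>h x - h x'\<bar> + \<bar>height_approx m (h x, k, s) - height_approx m (h x', k, s)\<bar> / 2"
      using g_lipschitz adm[THEN admissible_fst] h(2) height_approx_mem[OF adm(1)]
      by (simp add: pre)
    also have "\<dots> \<le> \<beta> / 2 * \<bar>h x - h x'\<bar> + \<beta> * \<bar>h x - h x'\<bar> / 2"
      using Suc.IH[OF adm h(2)] by simp
    also have "\<dots> = \<beta> * \<bar>h x - h x'\<bar>" by simp
    also have "\<dots> \<le> \<beta> * \<bar>x - x'\<bar>"
      using h(1) beta_gt_1 by (intro mult_left_mono) auto
    finally show ?case .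
  qed
  moreover have "(\<lambda>m. \<bar>height_approx m (x, n, r) - height_approx m (x', n, r)\<bar>)
      \<longlonglongrightarrow> \<bar>height (x, n, r) - height (x', n, r)\<bar>"
    by (intro tendsto_intros height_approx_tendsto assms)
  ultimately show ?thesis by (meson LIMSEQ_le_const2)
qed

section \<open>Separation of the heights of different codes\<close>

lemma branch_images_apart:
  assumes "x1 \<in> lorenz_I - {0}" "x2 \<in> lorenz_I - {0}" "sgn x1 \<noteq> sgn x2" "f x1 = f x2"
  shows "(\<bar>x1\<bar> powr \<beta> + \<bar>x2\<bar> powr \<beta>) / 2 < \<bar>c (sgn x1) - c (sgn x2)\<bar>"
proof (rule ccontr)
  define A1 A2 D where A1_A2_D_def: "A1 = \<bar>x1\<bar> powr \<beta>" "A2 = \<bar>x2\<bar> powr \<beta>"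
    "D = c (sgn x1) - c (sgn x2)"
  assume "\<not> ?thesis"
  then have D: "\<bar>D\<bar> \<le> (A1 + A2) / 2" by (simp add: A1_A2_D_def)
  have A: "0 < A1" "0 < A2" using assms by (auto simp: A1_A2_D_def)
  \<comment> \<open>If the image intervals met, there would be two heights with a common image:
    \<open>y\<close> solves \<open>D = y * (A1 + A2)\<close>, and the factors
    \<open>- \<epsilon>\<close> and \<open>\<epsilon>\<close> make the two contributions add up.
    This contradicts injectivity of the Poincare map.\<close>
  define y where "y = D / (A1 + A2)"
  have y: "\<bar>y\<bar> \<le> 1/2" using D A by (simp add: y_def abs_divide field_simps)
  have sq: "\<epsilon> s * \<epsilon> s = 1" for s
    using eps[of s] by (metis abs_mult_self_eq mult_1)
  let ?y1 = "- \<epsilon> (sgn x1) * y" and ?y2 = "\<epsilon> (sgn x2) * y"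
  have mem: "?y1 \<in> lorenz_I" "?y2 \<in> lorenz_I"
    using y by (auto simp: lorenz_I_iff abs_mult eps)
  have nz: "x1 \<noteq> 0" "x2 \<noteq> 0" using assms(1,2) by auto
  have alg: "(c1 + e1 * (- e1 * y * a1)) - (c2 + e2 * (e2 * y * a2)) = (c1 - c2) - y * (a1 + a2)"
    if "e1 * e1 = 1" "e2 * e2 = 1" for e1 e2 c1 c2 a1 a2 :: real
  proof -
    have "(c1 + e1 * (- e1 * y * a1)) - (c2 + e2 * (e2 * y * a2))
        = (c1 - c2) - (e1 * e1) * (y * a1) - (e2 * e2) * (y * a2)"
      by (simp add: algebra_simps)
    then show ?thesis by (simp add: that distrib_left)
  qed
  have "g x1 ?y1 - g x2 ?y2 = D - y * (A1 + A2)"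
    unfolding g_form[OF nz(1)] g_form[OF nz(2)] A1_A2_D_def by (rule alg[OF sq sq])
  also have "\<dots> = 0" using A by (simp add: y_def)
  finally have eq: "g x1 ?y1 = g x2 ?y2" by (simp only: right_minus_eq)
  have "poincare_map \<phi> lorenz_S (section_point x1 ?y1) = poincare_map \<phi> lorenz_S (section_point x2 ?y2)"
    by (simp only: poincare_form[OF assms(1) mem(1)] poincare_form[OF assms(2) mem(2)] assms(4) eq)
  moreover have "section_point x1 ?y1 \<in> lorenz_S_star" "section_point x2 ?y2 \<in> lorenz_S_star"
    using assms(1,2) mem unfolding section_point_mem_S_star_iff by blast+
  ultimately have "section_point x1 ?y1 = section_point x2 ?y2"
    using poincare_map_inj by blast
  then have "x1 = x2" by (metis section_point_nth(1))
  then show False using assms(3) by simp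
qed

text \<open>For each sign of \<open>x\<close> the gap between the image intervals is positive and
  continuous in the modulus, which ranges over a compact interval.\<close>

lemma uniform_gap:
  obtains \<gamma> where "0 < \<gamma>"
    "\<And>x y1 y2. valid 0 x \<Longrightarrow> y1 \<in> lorenz_I \<Longrightarrow> y2 \<in> lorenz_I \<Longrightarrow> \<gamma> \<le> \<bar>g (preA x) y1 - g (preB x) y2\<bar>"
proof -
  \<comment> \<open>Distance of the centres of the two image intervals minus both half-lengths, for
    \<open>x\<close> of sign \<open>s\<close> and modulus \<open>v\<close>.\<close>
  define w where "w = (\<lambda>s v. \<bar>c (- s) - c s\<bar> - (binv (- v) powr \<beta> + binv v powr \<beta>) / 2)"
  have cont: "continuous_on {p - \<eta>..p + \<eta>} (w s)" for s
    using theta_pos eta f_top_less binv_pos unfolding w_def binv_def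
    by (intro continuous_intros) (auto simp: binv_def)
  have pos: "0 < w (sgn x) \<bar>x\<bar>" if x: "valid 0 x" for x
  proof -
    have nz: "x \<noteq> 0" "\<bar>x\<bar> < 1/2" using x umax_bounds by (auto simp: valid_def)
    have mem: "preA x \<in> lorenz_I - {0}" "preB x \<in> lorenz_I - {0}"
      using preA_valid(1)[OF x] preB_valid(1)[OF x] umax_bounds by (auto simp: valid_def lorenz_I_iff)
    have "sgn x \<noteq> - sgn x" using nz(1) by (simp add: sgn_if)
    then have "(\<bar>preA x\<bar> powr \<beta> + \<bar>preB x\<bar> powr \<beta>) / 2 < \<bar>c (sgn (preA x)) - c (sgn (preB x))\<bar>"
      using preA_valid(3,4)[OF x] preB_valid(3,4)[OF x]
      by (intro branch_images_apart[OF mem]) metis+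
    then show ?thesis
      unfolding preA_abs_sgn(1,2)[OF nz] preB_abs_sgn(1,2)[OF nz(1)] w_def by simp
  qed
  have ex: "\<exists>\<gamma>>0. \<forall>v\<in>{p - \<eta>..p + \<eta>}. \<gamma> \<le> w s v" if s: "s = 1 \<or> s = -1" for s
  proof -
    obtain v where v: "v \<in> {p - \<eta>..p + \<eta>}" "\<forall>v'\<in>{p - \<eta>..p + \<eta>}. w s v \<le> w s v'"
      using continuous_attains_inf[OF _ _ cont[of s]] eta by auto
    have "valid 0 (s * v)" "sgn (s * v) = s" "\<bar>s * v\<bar> = v"
      using v(1) s eta by (auto simp: valid_0 sgn_if)
    then have "0 < w s v" using pos[of "s * v"] by simp
    then show ?thesis using v(2) by blast
  qed
  obtain \<gamma>1 where \<gamma>1: "0 < \<gamma>1" "\<And>v. v \<in> {p - \<eta>..p + \<eta>} \<Longrightarrow> \<gamma>1 \<le> w 1 v"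
    using ex[of 1] by auto
  obtain \<gamma>2 where \<gamma>2: "0 < \<gamma>2" "\<And>v. v \<in> {p - \<eta>..p + \<eta>} \<Longrightarrow> \<gamma>2 \<le> w (-1) v"
    using ex[of "-1"] by auto
  show ?thesis
  proof (rule that[of "min \<gamma>1 \<gamma>2"])
    fix x y1 y2 assume x: "valid 0 x" and y: "y1 \<in> lorenz_I" "y2 \<in> lorenz_I"
    note A = preA_valid[OF x] and B = preB_valid[OF x]
    have nz: "x \<noteq> 0" "\<bar>x\<bar> < 1/2" using x umax_bounds by (auto simp: valid_def)
    have pre: "\<bar>preA x\<bar> = binv (- \<bar>x\<bar>)" "\<bar>preB x\<bar> = binv \<bar>x\<bar>"
      using preA_abs_sgn(1)[OF nz] preB_abs_sgn(1)[OF nz(1)] by auto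
    have nz': "preA x \<noteq> 0" "preB x \<noteq> 0" using A(1) B(1) by (auto simp: valid_def)
    have "sgn x = 1 \<or> sgn x = -1" using nz by (auto simp: sgn_if)
    moreover have "\<bar>x\<bar> \<in> {p - \<eta>..p + \<eta>}" using x by (auto simp: valid_0 abs_le_iff)
    ultimately have 1: "min \<gamma>1 \<gamma>2 \<le> w (sgn x) \<bar>x\<bar>"
      using \<gamma>1(2)[of "\<bar>x\<bar>"] \<gamma>2(2)[of "\<bar>x\<bar>"] by (auto simp: min_le_iff_disj)
    have 2: "w (sgn x) \<bar>x\<bar> \<le> \<bar>g (preA x) y1 - g (preB x) y2\<bar>"
    proof -
      have small: "\<bar>\<epsilon> s * (y * z powr \<beta>)\<bar> \<le> z powr \<beta> / 2" if "y \<in> lorenz_I" for s y z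
        using that mult_right_mono[of "\<bar>y\<bar>" "1/2" "z powr \<beta>"] by (simp add: abs_mult eps lorenz_I_iff)
      have tri: "\<bar>d1 - d2\<bar> - (a1 + a2) / 2 \<le> \<bar>d1 + u1 - (d2 + u2)\<bar>"
        if "\<bar>u1\<bar> \<le> a1 / 2" "\<bar>u2\<bar> \<le> a2 / 2" for d1 d2 a1 a2 u1 u2 :: real
        using that unfolding add_divide_distrib by linarith
      show ?thesis
        unfolding g_form[OF nz'(1)] g_form[OF nz'(2)] w_def A(3) B(3) pre
        by (rule tri[OF small[OF y(1)] small[OF y(2)]])
    qed
    show "min \<gamma>1 \<gamma>2 \<le> \<bar>g (preA x) y1 - g (preB x) y2\<bar>"
      using 1 2 by (rule order_trans)
  qed (simp only: min_less_iff_conj \<gamma>1(1) \<gamma>2(1))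
qed

text \<open>Where the codes split, the heights differ by at least \<gamma>. Each step forward from
  there shrinks the difference by a factor at least \<open>\<rho>\<close>, and each common binary
  digit accounts for at most \<open>N + 1\<close> steps.\<close>

lemma height_separation:
  obtains \<gamma> :: real and K :: nat where "0 < \<gamma>" "0 < K"
    "\<And>x r r'. admissible (x, 0, r) \<Longrightarrow> admissible (x, 0, r') \<Longrightarrow>
      \<gamma> * \<bar>r - r'\<bar> ^ K \<le> \<bar>height (x, 0, r) - height (x, 0, r')\<bar>"
proof -
  obtain \<gamma> where \<gamma>: "0 < \<gamma>"
    "\<And>x y1 y2. valid 0 x \<Longrightarrow> y1 \<in> lorenz_I \<Longrightarrow> y2 \<in> lorenz_I \<Longrightarrow> \<gamma> \<le> \<bar>g (preA x) y1 - g (preB x) y2\<bar>"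
    using uniform_gap by blast
  define \<rho> where "\<rho> = umin powr \<beta>"
  have \<rho>: "0 < \<rho>" "\<rho> \<le> 1"
  proof -
    have "umin \<le> binv (p + \<eta>)"
      unfolding umin_def using umax_bounds eta by (intro binv_mono) auto
    then show "0 < \<rho>" "\<rho> \<le> 1"
      using umin_pos umax_bounds beta_gt_1 by (auto simp: \<rho>_def intro!: powr_le1)
  qed
  \<comment> \<open>Removing a digit doubles \<open>\<bar>r - r'\<bar>\<close>; the resulting factor
    \<open>2 ^ K\<close> must outweigh the loss \<open>\<rho> ^ Suc N\<close>.\<close>
  obtain K where K: "(1/2::real) ^ K < \<rho> ^ Suc N"
    using real_arch_pow_inv[of "\<rho> ^ Suc N" "1/2"] \<rho> by auto
  have "\<rho> ^ Suc N \<le> 1" using \<rho> by (intro power_le_one) auto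
  then have K0: "0 < K" using K by (cases K) auto
  have K2: "1 \<le> \<rho> ^ Suc N * 2 ^ K"
    using K by (simp add: power_divide divide_less_eq)
  have K1: "1 \<le> \<rho> * 2 ^ K"
  proof -
    have "\<rho> ^ Suc N \<le> \<rho>" using \<rho> power_decreasing[of 1 "Suc N" \<rho>] by simp
    then have "\<rho> ^ Suc N * 2 ^ K \<le> \<rho> * 2 ^ K" by (intro mult_right_mono) auto
    then show ?thesis using K2 by linarith
  qed
  have step: "\<rho> * \<bar>height (pred_state \<sigma>) - height (pred_state \<sigma>')\<bar> \<le> \<bar>height \<sigma> - height \<sigma>'\<bar>"
    if adm: "admissible \<sigma>" "admissible \<sigma>'" and eq: "fst (pred_state \<sigma>) = fst (pred_state \<sigma>')" for \<sigma> \<sigma>'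
  proof -
    have nz: "fst (pred_state \<sigma>) \<noteq> 0" using admissible_fst pred_state_admissible(1)[OF adm(1)] by blast
    have "\<rho> \<le> \<bar>fst (pred_state \<sigma>)\<bar> powr \<beta>"
      unfolding \<rho>_def using umin_pos beta_gt_1 pred_state_admissible(2)[OF adm(1)] by (intro powr_mono2) auto
    then have "\<rho> * \<bar>height (pred_state \<sigma>) - height (pred_state \<sigma>')\<bar>
        \<le> \<bar>fst (pred_state \<sigma>)\<bar> powr \<beta> * \<bar>height (pred_state \<sigma>) - height (pred_state \<sigma>')\<bar>"
      by (rule mult_right_mono) simp
    also have "\<dots> = \<bar>height \<sigma> - height \<sigma>'\<bar>"
      using height_pred[OF adm(1)] height_pred[OF adm(2)] nz
      by (simp add: g_form abs_mult eps eq flip: eq right_diff_distrib left_diff_distrib)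
    finally show ?thesis .
  qed
  \<comment> \<open>The factor \<open>\<rho> ^ n\<close> pays for the pending \<open>preA\<close>
    steps. The outer induction on \<open>m\<close> counts digits, the inner one on \<open>n\<close>
    these steps.\<close>
  have sep: "\<rho> ^ n * (\<gamma> * \<bar>r - r'\<bar> ^ K) \<le> \<bar>height (x, n, r) - height (x, n, r')\<bar>"
    if "(1/2) ^ m \<le> \<bar>r - r'\<bar>" "admissible (x, n, r)" "admissible (x, n, r')" for m n x r r'
    using that
  proof (induction m arbitrary: n x r r')
    \<comment> \<open>Impossible, as two numbers in \<open>[0, 1)\<close> differ by less than
      1.\<close>
    case 0
    then show ?case by auto
  next
    case (Suc m)
    note outer = Suc.IH
    show ?case using Suc.prems
    proof (induction n arbitrary: x)
      case (Suc n)
      have "\<rho> ^ Suc n * (\<gamma> * \<bar>r - r'\<bar> ^ K) = \<rho> * (\<rho> ^ n * (\<gamma> * \<bar>r - r'\<bar> ^ K))" by simp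
      also have "\<dots> \<le> \<rho> * \<bar>height (preA x, n, r) - height (preA x, n, r')\<bar>"
        using Suc.IH[of "preA x"] Suc.prems preA_valid(1)[of "Suc n" x] \<rho>
        by (intro mult_left_mono) auto
      also have "\<dots> \<le> \<bar>height (x, Suc n, r) - height (x, Suc n, r')\<bar>"
        using step[of "(x, Suc n, r)" "(x, Suc n, r')"] Suc.prems by simp
      finally show ?case .
    next
      case 0
      have v: "valid 0 x" and r: "0 \<le> r" "r < 1" "0 \<le> r'" "r' < 1" using 0 by auto
      have "\<bar>r - r'\<bar> ^ K \<le> 1" using r by (intro power_le_one) auto
      then have le: "\<gamma> * \<bar>r - r'\<bar> ^ K \<le> \<gamma>" using \<gamma>(1) by simp
      have two: "(2 * \<bar>r - r'\<bar>) ^ K = 2 ^ K * \<bar>r - r'\<bar> ^ K" by (rule power_mult_distrib)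
      note I = height_mem[OF pred_state_admissible(1)]
      consider "r < 1/2" "r' < 1/2" | "r < 1/2" "\<not> r' < 1/2" | "\<not> r < 1/2" "r' < 1/2"
        | "\<not> r < 1/2" "\<not> r' < 1/2" by blast
      then show ?case
      proof cases
        case 1
        have "\<bar>2 * r - 2 * r'\<bar> = 2 * \<bar>r - r'\<bar>" by (simp add: abs_if)
        then have "\<gamma> * (2 ^ K * \<bar>r - r'\<bar> ^ K) \<le> \<bar>height (preA x, 0, 2 * r) - height (preA x, 0, 2 * r')\<bar>"
          using outer[of "2 * r" "2 * r'" "preA x" 0] 1 0 preA_valid(1)[OF v] by (simp add: two)
        then have "\<rho> * (\<gamma> * (2 ^ K * \<bar>r - r'\<bar> ^ K)) \<le> \<rho> * \<bar>height (preA x, 0, 2 * r) - height (preA x, 0, 2 * r')\<bar>"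
          using \<rho> by (intro mult_left_mono) auto
        also have "\<dots> \<le> \<bar>height (x, 0, r) - height (x, 0, r')\<bar>"
          using step[of "(x, 0, r)" "(x, 0, r')"] 0 1 by simp
        finally have "(\<rho> * 2 ^ K) * (\<gamma> * \<bar>r - r'\<bar> ^ K) \<le> \<bar>height (x, 0, r) - height (x, 0, r')\<bar>"
          by (simp add: mult_ac)
        moreover have "1 * (\<gamma> * \<bar>r - r'\<bar> ^ K) \<le> (\<rho> * 2 ^ K) * (\<gamma> * \<bar>r - r'\<bar> ^ K)"
          using K1 \<gamma>(1) by (intro mult_right_mono) auto
        ultimately show ?thesis by simp
      next
        \<comment> \<open>The codes split here: \<open>preA\<close> for \<open>r\<close>,
          \<open>preB\<close> for \<open>r'\<close>.\<close>
        case 2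
        then show ?thesis
          using \<gamma>(2)[OF v I I, of "(x, 0, r)" "(x, 0, r')"] le 0
          by (simp add: height_pred)
      next
        case 3
        then show ?thesis
          using \<gamma>(2)[OF v I I, of "(x, 0, r')" "(x, 0, r)"] le 0
          by (simp add: height_pred abs_minus_commute)
      next
        \<comment> \<open>A common digit 1: one factor \<open>\<rho>\<close> for
          \<open>preB\<close>, and \<open>\<rho> ^ N\<close> for the \<open>preA\<close> steps it
          imposes.\<close>
        case 4
        let ?D = "\<bar>height (preB x, N, 2 * r - 1) - height (preB x, N, 2 * r' - 1)\<bar>"
        have "\<bar>2 * r - 1 - (2 * r' - 1)\<bar> = 2 * \<bar>r - r'\<bar>" by (simp add: abs_if)
        then have "\<rho> ^ N * (\<gamma> * (2 ^ K * \<bar>r - r'\<bar> ^ K)) \<le> ?D"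
          using outer[of "2 * r - 1" "2 * r' - 1" "preB x" N] 4 0 preB_valid(1)[OF v] by (simp add: two)
        then have "\<rho> * (\<rho> ^ N * (\<gamma> * (2 ^ K * \<bar>r - r'\<bar> ^ K))) \<le> \<rho> * ?D"
          using \<rho> by (intro mult_left_mono) auto
        also have "\<dots> \<le> \<bar>height (x, 0, r) - height (x, 0, r')\<bar>"
          using step[of "(x, 0, r)" "(x, 0, r')"] 0 4 by simp
        finally have "(\<rho> ^ Suc N * 2 ^ K) * (\<gamma> * \<bar>r - r'\<bar> ^ K) \<le> \<bar>height (x, 0, r) - height (x, 0, r')\<bar>"
          by (simp add: mult_ac)
        moreover have "1 * (\<gamma> * \<bar>r - r'\<bar> ^ K) \<le> (\<rho> ^ Suc N * 2 ^ K) * (\<gamma> * \<bar>r - r'\<bar> ^ K)"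
          using K2 \<gamma>(1) by (intro mult_right_mono) auto
        ultimately show ?thesis by simp
      qed
    qed
  qed
  show ?thesis
  proof (rule that[OF \<gamma>(1) K0])
    fix x r r' assume adm: "admissible (x, 0, r)" "admissible (x, 0, r')"
    show "\<gamma> * \<bar>r - r'\<bar> ^ K \<le> \<bar>height (x, 0, r) - height (x, 0, r')\<bar>"
    proof (cases "r = r'")
      case True
      then show ?thesis using K0 by (simp add: zero_power)
    next
      case False
      then obtain m where "(1/2) ^ m < \<bar>r - r'\<bar>"
        using real_arch_pow_inv[of "\<bar>r - r'\<bar>" "1/2"] by auto
      then show ?thesis using sep[of m r r' x 0] adm by simp
    qed
  qed
qed

section \<open>Dimension of the attractor\<close>

text \<open>Over a common \<open>x\<close> the height difference controls
  \<open>\<bar>r - r'\<bar> ^ K\<close>; passing from \<open>x'\<close> to \<open>x\<close> costs a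
  Lipschitz term, and taking \<open>K\<close>-th roots gives the exponent.\<close>

lemma attractor_parametrization_holder:
  obtains C and K :: nat where "0 < C" "0 < K"
    "\<And>t t' x x' r r'. \<lbrakk>t \<in> {0..return_lower}; t' \<in> {0..return_lower}; x \<in> {p - \<eta>..p + \<eta>};
        x' \<in> {p - \<eta>..p + \<eta>}; r \<in> {0..<1}; r' \<in> {0..<1}\<rbrakk> \<Longrightarrow>
      (let d = dist (\<phi> t (section_point x (height (x, 0, r)))) (\<phi> t' (section_point x' (height (x', 0, r'))))
       in \<bar>t - t'\<bar> \<le> C * d \<and> \<bar>x - x'\<bar> \<le> C * d \<and> \<bar>r - r'\<bar> \<le> C * d powr (1 / K))"
proof -
  obtain C where C: "0 < C" "\<And>t t' x x' y y'. \<lbrakk>t \<in> {0..return_lower}; t' \<in> {0..return_lower};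
        x \<in> lorenz_I; x' \<in> lorenz_I; y \<in> lorenz_I; y' \<in> lorenz_I\<rbrakk> \<Longrightarrow>
      (let d = dist (\<phi> t (section_point x y)) (\<phi> t' (section_point x' y'))
       in \<bar>t - t'\<bar> \<le> C * d \<and> \<bar>x - x'\<bar> \<le> C * d \<and> \<bar>y - y'\<bar> \<le> C * d)"
    using flow_box_coordinates by blast
  obtain \<gamma> :: real and K :: nat where \<gamma>: "0 < \<gamma>" "0 < K"
    "\<And>x r r'. admissible (x, 0, r) \<Longrightarrow> admissible (x, 0, r') \<Longrightarrow>
      \<gamma> * \<bar>r - r'\<bar> ^ K \<le> \<bar>height (x, 0, r) - height (x, 0, r')\<bar>"
    using height_separation by blast
  define M where "M = (1 + \<beta>) * C / \<gamma>"
  define C' where "C' = max C (M powr (1 / K))"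
  have M: "0 < M" using C(1) \<gamma>(1) beta_gt_1 by (simp add: M_def)
  have C': "0 < C'" "C \<le> C'" "M powr (1 / K) \<le> C'" using C(1) by (auto simp: C'_def)
  show ?thesis
  proof (rule that[OF C'(1) \<gamma>(2)])
    fix t t' x x' r r' :: real
    assume t: "t \<in> {0..return_lower}" "t' \<in> {0..return_lower}"
      and x: "x \<in> {p - \<eta>..p + \<eta>}" "x' \<in> {p - \<eta>..p + \<eta>}" and r: "r \<in> {0..<1}" "r' \<in> {0..<1}"
    define y y' d where y: "y = height (x, 0, r)" "y' = height (x', 0, r')"
      and d: "d = dist (\<phi> t (section_point x y)) (\<phi> t' (section_point x' y'))"
    have pos: "0 < x" "0 < x'" using x eta by auto
    have adm: "admissible (u, 0, s)" if "u \<in> {p - \<eta>..p + \<eta>}" "s \<in> {0..<1}" for u s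
      using that eta by (auto simp: valid_0 abs_le_iff)
    have I: "x \<in> lorenz_I" "x' \<in> lorenz_I" "y \<in> lorenz_I" "y' \<in> lorenz_I"
      using admissible_fst[OF adm[OF x(1) r(1)]] admissible_fst[OF adm[OF x(2) r(2)]]
        height_mem[OF adm[OF x(1) r(1)]] height_mem[OF adm[OF x(2) r(2)]] by (simp_all add: y)
    have box: "\<bar>t - t'\<bar> \<le> C * d" "\<bar>x - x'\<bar> \<le> C * d" "\<bar>y - y'\<bar> \<le> C * d"
      using C(2)[OF t I] by (simp_all add: Let_def d)
    have "\<gamma> * \<bar>r - r'\<bar> ^ K \<le> \<bar>height (x, 0, r) - height (x, 0, r')\<bar>"
      using \<gamma>(3) adm x r by blast
    \<comment> \<open>The intermediate state \<open>(x, 0, r')\<close> combines the position of one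
      point with the code of the other.\<close>
    also have "\<dots> \<le> \<bar>y - y'\<bar> + \<bar>height (x, 0, r') - height (x', 0, r')\<bar>"
      by (simp add: y)
    also have "\<dots> \<le> C * d + \<beta> * \<bar>x - x'\<bar>"
      using box(3) height_lipschitz[OF adm[OF x(1) r(2)] adm[OF x(2) r(2)]] pos by simp
    also have "\<dots> \<le> C * d + \<beta> * (C * d)"
      using box(2) beta_gt_1 by simp
    also have "\<dots> = \<gamma> * (M * d)" using \<gamma>(1) by (simp add: M_def field_simps)
    finally have "\<bar>r - r'\<bar> ^ K \<le> M * d" using \<gamma>(1) by simp
    moreover have "(\<bar>r - r'\<bar> ^ K) powr (1 / K) = \<bar>r - r'\<bar>"
      using \<gamma>(2) by (cases "r = r'") (simp_all add: powr_powr flip: powr_realpow)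
    ultimately have "\<bar>r - r'\<bar> \<le> (M * d) powr (1 / K)"
      using powr_mono2[of "1 / K" "\<bar>r - r'\<bar> ^ K" "M * d"] by simp
    also have "\<dots> = M powr (1 / K) * d powr (1 / K)"
      using M by (simp add: powr_mult d)
    also have "\<dots> \<le> C' * d powr (1 / K)"
      using C'(3) by (rule mult_right_mono) simp
    finally have "\<bar>r - r'\<bar> \<le> C' * d powr (1 / K)" .
    moreover have "C * d \<le> C' * d" using C'(2) by (rule mult_right_mono) (simp add: d)
    ultimately show "let d = dist (\<phi> t (section_point x (height (x, 0, r)))) (\<phi> t' (section_point x' (height (x', 0, r'))))
       in \<bar>t - t'\<bar> \<le> C' * d \<and> \<bar>x - x'\<bar> \<le> C' * d \<and> \<bar>r - r'\<bar> \<le> C' * d powr (1 / K)"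
      using box unfolding Let_def y[symmetric] d[symmetric] by linarith
  qed
qed

text \<open>
  The parameters of a set of diameter \<open>D\<close> lie in a box with sides of order \<open>D\<close>, \<open>D\<close> and \<open>D\<^sup>1\<^sup>/\<^sup>K\<close>.
\<close>

lemma hausdorff_dim_attractor: "2 < hausdorff_dim (lorenz_attractor \<phi>)"
proof -
  obtain C and K :: nat where C: "0 < C" "0 < K"
    "\<And>t t' x x' r r'. \<lbrakk>t \<in> {0..return_lower}; t' \<in> {0..return_lower}; x \<in> {p - \<eta>..p + \<eta>};
        x' \<in> {p - \<eta>..p + \<eta>}; r \<in> {0..<1}; r' \<in> {0..<1}\<rbrakk> \<Longrightarrow>
      (let d = dist (\<phi> t (section_point x (height (x, 0, r)))) (\<phi> t' (section_point x' (height (x', 0, r'))))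
       in \<bar>t - t'\<bar> \<le> C * d \<and> \<bar>x - x'\<bar> \<le> C * d \<and> \<bar>r - r'\<bar> \<le> C * d powr (1 / K))"
    using attractor_parametrization_holder by blast
  \<comment> \<open>Ending the code interval at 1/2 gives a closed box on which \<open>r < 1\<close>
    holds.\<close>
  define V :: "(real \<times> real \<times> real) set" where "V = cbox (0, p - \<eta>, 0) (return_lower, p + \<eta>, 1/2)"
  define \<Psi> where "\<Psi> = (\<lambda>(t, x, r). \<phi> t (section_point x (height (x, 0, r))))"
  have V: "(t, x, r) \<in> V \<longleftrightarrow> t \<in> {0..return_lower} \<and> x \<in> {p - \<eta>..p + \<eta>} \<and> r \<in> {0..1/2}" for t x r
    by (auto simp: V_def cbox_Pair_eq)
  have vol: "emeasure lborel (cbox (a, b, c) (a', b', c')) = ennreal ((a' - a) * (b' - b) * (c' - c))"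
    if "a \<le> a'" "b \<le> b'" "c \<le> c'" for a b c a' b' c' :: real
    using that emeasure_eq_ennreal_measure[of lborel "cbox (a, b, c) (a', b', c')"]
      emeasure_lborel_cbox_finite[of "(a, b, c)" "(a', b', c')"]
    by (simp add: content_Pair less_top[symmetric] mult.assoc)
  have "ennreal (2 + 1 / K) \<le> hausdorff_dim (lorenz_attractor \<phi>)"
  \<comment> \<open>The constant comes from the volume of a box with sides
    \<open>2 * \<delta>\<close>, \<open>2 * \<delta>\<close> and \<open>2 * \<rho>\<close>, each
    containing one factor \<open>C\<close>.\<close>
  proof (rule hausdorff_dim_ge_mass[where M = lborel and V = V and \<Psi> = \<Psi> and C = "8 * C ^ 3"])
    show "0 < 8 * C ^ 3" using C(1) by simp
    show "V \<in> sets lborel" by (simp add: V_def)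
    show "0 < emeasure lborel V"
      using return_lower_pos eta by (simp add: V_def vol)
    show "\<Psi> ` V \<subseteq> lorenz_attractor \<phi>"
    proof
      fix q assume "q \<in> \<Psi> ` V"
      then obtain t x r where "q = \<phi> t (section_point x (height (x, 0, r)))" "(t, x, r) \<in> V"
        by (auto simp: \<Psi>_def)
      moreover from this have "admissible (x, 0, r)" using eta by (auto simp: V valid_0 abs_le_iff)
      ultimately show "q \<in> lorenz_attractor \<phi>"
        using Lambda_P_mem[of "(x, 0, r)"] by (auto simp: lorenz_attractor_def)
    qed
    fix U :: "(real^3) set" assume U: "U \<noteq> {}" "bounded U" "diameter U \<le> 1"
    define D where "D = diameter U"
    have D: "0 \<le> D" using U(2) by (simp add: D_def diameter_ge_0)
    show "\<exists>B\<in>sets lborel. {v \<in> V. \<Psi> v \<in> U} \<subseteq> B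
        \<and> emeasure lborel B \<le> ennreal (8 * C ^ 3 * diameter U powr (2 + 1 / K))"
    proof (cases "{v \<in> V. \<Psi> v \<in> U} = {}")
      case True
      then show ?thesis by (intro bexI[of _ "{}"]) auto
    next
      case False
      \<comment> \<open>Any parameter that \<open>\<Psi>\<close> sends into \<open>U\<close> can
        serve as the centre of the box.\<close>
      then obtain t0 x0 r0 where v0: "(t0, x0, r0) \<in> V" "\<Psi> (t0, x0, r0) \<in> U" by auto
      define \<delta> where "\<delta> = C * D"
      define \<rho> where "\<rho> = C * D powr (1 / K)"
      have nonneg: "0 \<le> \<delta>" "0 \<le> \<rho>" using C(1) D by (simp_all add: \<delta>_def \<rho>_def)
      let ?B = "cbox (t0 - \<delta>, x0 - \<delta>, r0 - \<rho>) (t0 + \<delta>, x0 + \<delta>, r0 + \<rho>)"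
      have "(t, x, r) \<in> ?B" if v: "(t, x, r) \<in> V" "\<Psi> (t, x, r) \<in> U" for t x r
      proof -
        let ?d = "dist (\<Psi> (t, x, r)) (\<Psi> (t0, x0, r0))"
        have "?d \<le> D"
          unfolding D_def using U(2) v(2) v0(2) by (rule diameter_bounded_bound)
        then have "C * ?d \<le> \<delta>" "C * ?d powr (1 / K) \<le> \<rho>"
          using C(1) by (auto simp: \<delta>_def \<rho>_def intro!: powr_mono2)
        moreover have "\<bar>t - t0\<bar> \<le> C * ?d \<and> \<bar>x - x0\<bar> \<le> C * ?d \<and> \<bar>r - r0\<bar> \<le> C * ?d powr (1 / K)"
          using C(3)[of t t0 x x0 r r0] v(1) v0(1) by (simp add: V \<Psi>_def Let_def)
        ultimately have "\<bar>t - t0\<bar> \<le> \<delta>" "\<bar>x - x0\<bar> \<le> \<delta>" "\<bar>r - r0\<bar> \<le> \<rho>" by linarith+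
        then show ?thesis by (auto simp: cbox_Pair_eq abs_le_iff)
      qed
      then have "{v \<in> V. \<Psi> v \<in> U} \<subseteq> ?B" by auto
      moreover have "emeasure lborel ?B \<le> ennreal (8 * C ^ 3 * diameter U powr (2 + 1 / K))"
      proof -
        have "D powr (2 + 1 / K) = D * D * D powr (1 / K)"
          using D by (simp add: powr_add power2_eq_square)
        then have "8 * C ^ 3 * D powr (2 + 1 / K) = (2 * \<delta>) * (2 * \<delta>) * (2 * \<rho>)"
          by (simp add: \<delta>_def \<rho>_def power3_eq_cube)
        then show ?thesis using nonneg by (simp add: vol D_def)
      qed
      ultimately show ?thesis by (intro bexI[of _ ?B]) auto
    qed
  qed
  moreover have "(2::ennreal) < ennreal (2 + 1 / K)"
    using C(2) by (simp flip: ennreal_numeral add: ennreal_less_iff)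
  ultimately show ?thesis by (rule less_le_trans[rotated])
qed

end

theorem theorem1:
  fixes lam1 lam2 lam3 \<alpha> \<beta> \<theta> b0 b1 :: real
    and g0 g1 :: "real \<times> real \<Rightarrow> real"
    and X :: "real^3 \<Rightarrow> real^3"
    and \<phi> :: "real \<Rightarrow> real^3 \<Rightarrow> real^3"
  assumes "geometric_lorenz_flow lam1 lam2 lam3 \<alpha> \<beta> \<theta> b0 b1 g0 g1 X \<phi>"
  shows "hausdorff_dim (lorenz_attractor \<phi>) > 2"
proof -
  interpret geometric_lorenz_flow lam1 lam2 lam3 \<alpha> \<beta> \<theta> b0 b1 g0 g1 X \<phi> by (fact assms)
  obtain \<epsilon> c :: "real \<Rightarrow> real" where g: "\<And>s. \<bar>\<epsilon> s\<bar> = 1"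
    "\<And>x y. x \<noteq> 0 \<Longrightarrow> lorenz_g \<alpha> \<beta> g0 g1 x y = c (sgn x) + \<epsilon> (sgn x) * (y * \<bar>x\<bar> powr \<beta>)"
    using lorenz_g_form by blast
  obtain p \<eta> :: real and N :: nat where p: "binv (- p) = p" "0 < \<eta>" "\<eta> < p" "p + \<eta> < f_top"
    "1/2 \<le> \<eta> * sqrt 2 ^ N"
    using horseshoe_parameters_exist by blast
  interpret lorenz_horseshoe lam1 lam2 lam3 \<alpha> \<beta> \<theta> b0 b1 g0 g1 X \<phi> \<epsilon> c p \<eta> N
    by unfold_locales (fact g p)+
  show ?thesis by (rule hausdorff_dim_attractor)
qed

end
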